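(* Let \[ \mathcal{F}=\Big\{\tfrac12\sum_{i=1}^{\infty}\left(-\tfrac32\right)^{-i}\varphi(d_{-i})\;\Big|\;d_{-i}\in\{0,1,2\}\Big\}\subset\mathbb{K}. \] Then the boundary $\partial\mathcal{F}$ of $\mathcal{F}$ in $\mathbb{K}$ satisfies $\mu(\partial\mathcal{F})=0$.
   Context: $\mathbb{Q}_2$ is the field of $2$-adic numbers with $2$-adic absolute value $|\cdot|_2$, and $\mathbb{Z}_2=\{\sum_{i\ge0}c_i2^i\mid c_i\in\{0,1\}\}$ is the ring of $2$-adic integers. $\mathbb{K}=\mathbb{R}\times\mathbb{Q}_2$ with componentwise addition, multiplication by a rational $\alpha$ given by $\alpha(x_1,x_2)=(\alpha x_1,\alpha x_2)$, and the metric $\mathbf{d}((x_1,x_2),(y_1,y_2))=\max\{|x_1-y_1|,|x_2-y_2|_2\}$. $\varphi:\mathbb{Q}\to\mathbb{K}$ is $\varphi(z)=(z,z)$. The measure $\mu=\mu_\infty\times\mu_2$ on $\mathbb{K}$ is the product of the Lebesgue measure $\mu_\infty$ on $\mathbb{R}$ and the Haar measure $\mu_2$ on $\mathbb{Q}_2$ normalized by $\mu_2(2^\ell\mathbb{Z}_2)=2^{-\ell}$ for $\ell\in\mathbb{Z}$. *)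

theory Defs
  imports "HOL-Analysis.Analysis" "HOL-Computational_Algebra.Computational_Algebra"
begin

text \<open>
  \<open>Q2\<close> is the completion of the rationals with respect to the 2-adic absolute value:
  Cauchy sequences of rationals modulo null sequences.
\<close>

definition abs2_rat :: "rat \<Rightarrow> real"
  where "abs2_rat x =
    (if x = 0 then 0
     else 2 powi (int (multiplicity 2 (snd (quotient_of x)))
                  - int (multiplicity 2 (fst (quotient_of x)))))"

lemma abs2_rat_0 [simp]: "abs2_rat 0 = 0"
  by (simp add: abs2_rat_def)

lemma abs2_rat_quotient:
  fixes a b :: int
  assumes "a \<noteq> 0" "b \<noteq> 0"
  shows "abs2_rat (of_int a / of_int b) = 2 powi (int (multiplicity 2 b) - int (multiplicity 2 a))"
proof -
  obtain p q where pq: "quotient_of (of_int a / of_int b) = (p, q)"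
    by fastforce
  have q: "q > 0" using quotient_of_denom_pos[OF pq] .
  have eq: "(of_int a / of_int b :: rat) = of_int p / of_int q"
    using quotient_of_div[OF pq] .
  hence "(of_int (a * q) :: rat) = of_int (p * b)"
    using assms q by (simp add: field_simps)
  hence cross: "a * q = p * b"
    by (simp only: of_int_eq_iff)
  have p: "p \<noteq> 0" using cross assms q by auto
  have "multiplicity 2 a + multiplicity 2 q = multiplicity 2 p + multiplicity 2 b"
    using arg_cong[OF cross, of "multiplicity 2"] assms p q
    by (simp add: prime_elem_multiplicity_mult_distrib)
  moreover have "(of_int a / of_int b :: rat) \<noteq> 0" using assms by simp
  ultimately show ?thesis
    unfolding abs2_rat_def pq by (auto intro!: arg_cong[of _ _ "\<lambda>k. 2 powi k"])
qed

lemma abs2_rat_of_int: "a \<noteq> 0 \<Longrightarrow> abs2_rat (of_int a) = 2 powi (- int (multiplicity 2 a))"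
  using abs2_rat_quotient[of a 1] by simp

lemma rat_quotientE:
  fixes x :: rat
  obtains a b :: int where "b \<noteq> 0" "x = of_int a / of_int b"
  by (metis quotient_of_div quotient_of_denom_pos less_irrefl surj_pair)

lemma abs2_rat_mult: "abs2_rat (x * y) = abs2_rat x * abs2_rat y"
proof (cases "x = 0 \<or> y = 0")
  case False
  obtain a b where ab: "b \<noteq> 0" "x = of_int a / of_int b" by (rule rat_quotientE)
  obtain c d where cd: "d \<noteq> 0" "y = of_int c / of_int d" by (rule rat_quotientE)
  have nz: "a \<noteq> 0" "c \<noteq> 0" using False ab cd by auto
  have "x * y = of_int (a * c) / of_int (b * d)" using ab cd by simp
  thus ?thesis
    using nz ab cd abs2_rat_quotient[of "a * c" "b * d"]
    by (simp add: abs2_rat_quotient prime_elem_multiplicity_mult_distrib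
          power_int_add[symmetric] algebra_simps)
qed auto

lemma abs2_rat_nonneg [simp]: "abs2_rat x \<ge> 0"
  by (simp add: abs2_rat_def)

lemma abs2_rat_eq_0_iff [simp]: "abs2_rat x = 0 \<longleftrightarrow> x = 0"
  by (simp add: abs2_rat_def)

lemma abs2_rat_1 [simp]: "abs2_rat 1 = 1"
  using abs2_rat_of_int[of 1] by simp

lemma abs2_rat_2: "abs2_rat 2 = 1 / 2"
  using abs2_rat_of_int[of 2] by (simp add: power_int_minus)

lemma abs2_rat_minus [simp]: "abs2_rat (- x) = abs2_rat x"
proof -
  have "abs2_rat (-1) = 1" using abs2_rat_of_int[of "-1"] by simp
  thus ?thesis using abs2_rat_mult[of "-1" x] by simp
qed

lemma abs2_rat_diff_commute: "abs2_rat (x - y) = abs2_rat (y - x)"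
  by (metis abs2_rat_minus minus_diff_eq)

lemma abs2_rat_inverse: "abs2_rat (inverse x) = inverse (abs2_rat x)"
proof (cases "x = 0")
  case False
  hence "abs2_rat x * abs2_rat (inverse x) = 1" by (simp flip: abs2_rat_mult)
  thus ?thesis by (metis inverse_unique)
qed simp

lemma abs2_rat_ultrametric: "abs2_rat (x + y) \<le> max (abs2_rat x) (abs2_rat y)"
proof (cases "x = 0 \<or> y = 0 \<or> x + y = 0")
  case False
  obtain a b where ab: "b \<noteq> 0" "x = of_int a / of_int b" by (rule rat_quotientE)
  obtain c d where cd: "d \<noteq> 0" "y = of_int c / of_int d" by (rule rat_quotientE)
  define m n e where "m = a * d" and "n = c * b" and "e = b * d"
  have e: "e \<noteq> 0" using ab cd by (simp add: e_def)
  have x: "x = of_int m / of_int e" and y: "y = of_int n / of_int e"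
    using ab cd by (simp_all add: m_def n_def e_def)
  have xy: "x + y = of_int (m + n) / of_int e" by (simp add: x y add_divide_distrib)
  have nz: "m \<noteq> 0" "n \<noteq> 0" "m + n \<noteq> 0" using False x y xy by auto
  have "2 ^ min (multiplicity 2 m) (multiplicity 2 n) dvd m + n"
    by (intro dvd_add multiplicity_dvd') auto
  hence le: "min (multiplicity 2 m) (multiplicity 2 n) \<le> multiplicity 2 (m + n)"
    using nz by (subst (asm) power_dvd_iff_le_multiplicity) auto
  have vs: "abs2_rat x = 2 powi (int (multiplicity 2 e) - int (multiplicity 2 m))"
    "abs2_rat y = 2 powi (int (multiplicity 2 e) - int (multiplicity 2 n))"
    "abs2_rat (x + y) = 2 powi (int (multiplicity 2 e) - int (multiplicity 2 (m + n)))"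
    unfolding xy unfolding x y using nz e by (simp_all only: abs2_rat_quotient not_False_eq_True)
  show ?thesis
  proof (cases "multiplicity 2 m \<le> multiplicity 2 n")
    case True
    hence "abs2_rat (x + y) \<le> abs2_rat x"
      unfolding vs using le by (intro power_int_increasing) auto
    thus ?thesis by simp
  next
    case False
    hence "abs2_rat (x + y) \<le> abs2_rat y"
      unfolding vs using le by (intro power_int_increasing) auto
    thus ?thesis by simp
  qed
qed (auto simp: max_def)

lemma abs2_rat_triangle: "abs2_rat (x + y) \<le> abs2_rat x + abs2_rat y"
  using abs2_rat_ultrametric[of x y] abs2_rat_nonneg[of x] abs2_rat_nonneg[of y] by linarith

lemma abs2_rat_diff_abs: "\<bar>abs2_rat x - abs2_rat y\<bar> \<le> abs2_rat (x - y)"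
  using abs2_rat_triangle[of "x - y" y] abs2_rat_triangle[of "y - x" x]
  by (auto simp: abs2_rat_diff_commute[of y x])

lemma abs2_rat_isosceles: "abs2_rat (x - y) < abs2_rat y \<Longrightarrow> abs2_rat x = abs2_rat y"
  using abs2_rat_ultrametric[of "x - y" y] abs2_rat_ultrametric[of "y - x" x]
  by (auto simp: abs2_rat_diff_commute[of y x] max_def split: if_splits)

lemma abs2_rat_parity:
  assumes "abs2_rat x \<le> 1"
  shows "abs2_rat x \<le> 1/2 \<or> abs2_rat (x - 1) \<le> 1/2"
proof -
  obtain a b where pq: "quotient_of x = (a, b)" by fastforce
  have b: "b > 0" using quotient_of_denom_pos[OF pq] .
  have x: "x = of_int a / of_int b" using quotient_of_div[OF pq] .
  have cop: "coprime a b" using quotient_of_coprime[OF pq] .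
  have even_le: "abs2_rat (of_int c / of_int b) \<le> 1/2" if "even c" "odd b" for c :: int
  proof -
    obtain k where c: "c = 2 * k" using \<open>even c\<close> by blast
    have "abs2_rat (of_int c / of_int b) = 1/2 * abs2_rat (of_int k / of_int b)"
      using abs2_rat_mult[of 2 "of_int k / of_int b"] by (simp add: c abs2_rat_2)
    moreover have "abs2_rat (of_int k / of_int b) \<le> 1"
    proof (cases "k = 0")
      case False
      thus ?thesis using b \<open>odd b\<close>
        by (simp add: abs2_rat_quotient not_dvd_imp_multiplicity_0 power_int_minus field_simps)
    qed simp
    ultimately show ?thesis by simp
  qed
  have "odd b"
  proof
    assume "even b"
    hence "odd a" using cop by (meson coprime_def odd_one)
    hence "a \<noteq> 0" by auto
    have "multiplicity 2 b > 0"
      using \<open>even b\<close> b by (simp add: multiplicity_gt_zero_iff)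
    moreover have "multiplicity 2 a = 0"
      using \<open>odd a\<close> by (simp add: not_dvd_imp_multiplicity_0)
    moreover have "(2::real) ^ multiplicity 2 b > 1" using calculation by simp
    ultimately have "abs2_rat x > 1"
      using \<open>a \<noteq> 0\<close> b by (simp add: x abs2_rat_quotient)
    thus False using assms by simp
  qed
  moreover have "x - 1 = of_int (a - b) / of_int b" using b by (simp add: x field_simps)
  ultimately show ?thesis using even_le[of a] even_le[of "a - b"] x by auto
qed

definition cauchy2 :: "(nat \<Rightarrow> rat) \<Rightarrow> bool"
  where "cauchy2 X \<longleftrightarrow> (\<forall>e>0. \<exists>N. \<forall>m\<ge>N. \<forall>n\<ge>N. abs2_rat (X m - X n) < e)"

definition null2 :: "(nat \<Rightarrow> rat) \<Rightarrow> bool"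
  where "null2 X \<longleftrightarrow> (\<lambda>n. abs2_rat (X n)) \<longlonglongrightarrow> 0"

lemma null2_add: "null2 X \<Longrightarrow> null2 Y \<Longrightarrow> null2 (\<lambda>n. X n + Y n)"
  unfolding null2_def
  by (rule tendsto_sandwich[of "\<lambda>_. 0" _ _ "\<lambda>n. abs2_rat (X n) + abs2_rat (Y n)"])
     (auto simp: abs2_rat_triangle intro!: tendsto_add_zero)

lemma null2_minus: "null2 X \<Longrightarrow> null2 (\<lambda>n. - X n)"
  by (simp add: null2_def)

lemma null2_swap: "null2 (\<lambda>n. X n - Y n) \<Longrightarrow> null2 (\<lambda>n. Y n - X n)"
  using null2_minus[of "\<lambda>n. X n - Y n"] by simp

lemma null2_trans:
  "null2 (\<lambda>n. X n - Y n) \<Longrightarrow> null2 (\<lambda>n. Y n - Z n) \<Longrightarrow> null2 (\<lambda>n. X n - Z n)"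
  by (drule (1) null2_add) simp

lemma null2_const_iff [simp]: "null2 (\<lambda>_. c) \<longleftrightarrow> c = 0"
  by (simp add: null2_def LIMSEQ_const_iff)

lemma cauchy2_const [simp]: "cauchy2 (\<lambda>_. c)"
  by (simp add: cauchy2_def)

lemma cauchy2_minus: "cauchy2 X \<Longrightarrow> cauchy2 (\<lambda>n. - X n)"
  unfolding cauchy2_def by (simp add: abs2_rat_diff_commute)

lemma cauchy2_add:
  assumes "cauchy2 X" "cauchy2 Y"
  shows "cauchy2 (\<lambda>n. X n + Y n)"
  unfolding cauchy2_def
proof (intro allI impI)
  fix e :: real assume "e > 0"
  obtain M where M: "abs2_rat (X m - X n) < e" if "m \<ge> M" "n \<ge> M" for m n
    using assms(1) \<open>e > 0\<close> unfolding cauchy2_def by blast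
  obtain N where N: "abs2_rat (Y m - Y n) < e" if "m \<ge> N" "n \<ge> N" for m n
    using assms(2) \<open>e > 0\<close> unfolding cauchy2_def by blast
  have "abs2_rat (X m + Y m - (X n + Y n)) < e" if "m \<ge> max M N" "n \<ge> max M N" for m n
    using abs2_rat_ultrametric[of "X m - X n" "Y m - Y n"] M[of m n] N[of m n] that
    by (simp add: algebra_simps)
  thus "\<exists>N. \<forall>m\<ge>N. \<forall>n\<ge>N. abs2_rat (X m + Y m - (X n + Y n)) < e" by blast
qed

lemma cauchy2_tendsto:
  assumes "cauchy2 X"
  shows "null2 X \<or> (\<exists>r>0. eventually (\<lambda>n. abs2_rat (X n) = r) sequentially)"
proof (rule disjCI)
  assume "\<not> (\<exists>r>0. eventually (\<lambda>n. abs2_rat (X n) = r) sequentially)"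
  hence no: "\<not> eventually (\<lambda>n. abs2_rat (X n) = r) sequentially" if "r > 0" for r
    using that by blast
  show "null2 X"
    unfolding null2_def
  proof (rule LIMSEQ_I)
    fix e :: real assume "e > 0"
    obtain N where N: "abs2_rat (X m - X n) < e" if "m \<ge> N" "n \<ge> N" for m n
      using assms \<open>e > 0\<close> unfolding cauchy2_def by blast
    have "abs2_rat (X n) < e" if n: "n \<ge> N" for n
    proof (rule ccontr)
      assume "\<not> abs2_rat (X n) < e"
      hence "abs2_rat (X m) = abs2_rat (X n)" if "m \<ge> N" for m
        using N[of m n] that n by (intro abs2_rat_isosceles) auto
      moreover have "abs2_rat (X n) > 0" using \<open>e > 0\<close> \<open>\<not> abs2_rat (X n) < e\<close> by simp
      ultimately show False using no[of "abs2_rat (X n)"]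
        by (auto simp: eventually_sequentially)
    qed
    thus "\<exists>N. \<forall>n\<ge>N. norm (abs2_rat (X n) - 0) < e" by auto
  qed
qed

lemma cauchy2_convergent: "cauchy2 X \<Longrightarrow> convergent (\<lambda>n. abs2_rat (X n))"
  using cauchy2_tendsto[of X] unfolding null2_def convergent_def
  by (metis tendsto_eventually)

lemma cauchy2_bounded:
  assumes "cauchy2 X"
  shows "Bseq (\<lambda>n. abs2_rat (X n))"
  using assms cauchy2_convergent convergent_imp_Bseq by blast

lemma null2_mult_bounded:
  assumes "Bseq (\<lambda>n. abs2_rat (X n))" "null2 Y"
  shows "null2 (\<lambda>n. X n * Y n)"
proof -
  obtain K where K: "K > 0" "\<And>n. abs2_rat (X n) \<le> K"
    using assms(1) by (auto simp: Bseq_def)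
  have "(\<lambda>n. K * abs2_rat (Y n)) \<longlonglongrightarrow> 0"
    using assms(2) unfolding null2_def by (rule tendsto_mult_right_zero)
  thus ?thesis
    unfolding null2_def
    by (rule tendsto_sandwich[of "\<lambda>_. 0", rotated 3])
       (auto simp: abs2_rat_mult intro!: always_eventually mult_right_mono K)
qed

lemma cauchy2_mult:
  assumes "cauchy2 X" "cauchy2 Y"
  shows "cauchy2 (\<lambda>n. X n * Y n)"
proof -
  obtain A where A: "A > 0" "\<And>n. abs2_rat (X n) \<le> A"
    using cauchy2_bounded[OF assms(1)] by (auto simp: Bseq_def)
  obtain B where B: "B > 0" "\<And>n. abs2_rat (Y n) \<le> B"
    using cauchy2_bounded[OF assms(2)] by (auto simp: Bseq_def)
  show ?thesis
    unfolding cauchy2_def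
  proof (intro allI impI)
    fix e :: real assume e: "e > 0"
    obtain M where M: "abs2_rat (X m - X n) < e / B" if "m \<ge> M" "n \<ge> M" for m n
      using assms(1) e B unfolding cauchy2_def by (meson divide_pos_pos)
    obtain N where N: "abs2_rat (Y m - Y n) < e / A" if "m \<ge> N" "n \<ge> N" for m n
      using assms(2) e A unfolding cauchy2_def by (meson divide_pos_pos)
    have "abs2_rat (X m * Y m - X n * Y n) < e" if mn: "m \<ge> max M N" "n \<ge> max M N" for m n
    proof -
      have "abs2_rat (X m * (Y m - Y n)) \<le> A * abs2_rat (Y m - Y n)"
        using A by (auto simp: abs2_rat_mult intro: mult_right_mono)
      also have "\<dots> < e" using A N[of m n] mn by (simp add: field_simps)
      finally have 1: "abs2_rat (X m * (Y m - Y n)) < e" .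
      have "abs2_rat ((X m - X n) * Y n) \<le> abs2_rat (X m - X n) * B"
        using B by (auto simp: abs2_rat_mult intro: mult_left_mono)
      also have "\<dots> < e" using B M[of m n] mn by (simp add: field_simps)
      finally have 2: "abs2_rat ((X m - X n) * Y n) < e" .
      have "X m * Y m - X n * Y n = X m * (Y m - Y n) + (X m - X n) * Y n"
        by (simp add: algebra_simps)
      thus ?thesis
        using 1 2 abs2_rat_ultrametric[of "X m * (Y m - Y n)" "(X m - X n) * Y n"]
        by simp
    qed
    thus "\<exists>N. \<forall>m\<ge>N. \<forall>n\<ge>N. abs2_rat (X m * Y m - X n * Y n) < e" by blast
  qed
qed

lemma cauchy2_inverse:
  assumes "cauchy2 X" "\<not> null2 X"
  shows "cauchy2 (\<lambda>n. inverse (X n))"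
proof -
  obtain r N where r: "r > 0" and N: "\<And>n. n \<ge> N \<Longrightarrow> abs2_rat (X n) = r"
    using cauchy2_tendsto[OF assms(1)] assms(2) by (auto simp: eventually_sequentially)
  show ?thesis
    unfolding cauchy2_def
  proof (intro allI impI)
    fix e :: real assume e: "e > 0"
    obtain M where M: "abs2_rat (X m - X n) < e * (r * r)" if "m \<ge> M" "n \<ge> M" for m n
      using assms(1) e r unfolding cauchy2_def by (meson mult_pos_pos)
    have "abs2_rat (inverse (X m) - inverse (X n)) < e"
      if mn: "m \<ge> max M N" "n \<ge> max M N" for m n
    proof -
      have nz: "X m \<noteq> 0" "X n \<noteq> 0" using N[of m] N[of n] mn r by auto
      hence "inverse (X m) - inverse (X n) = (X n - X m) * inverse (X m * X n)"
        by (simp add: field_simps)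
      hence "abs2_rat (inverse (X m) - inverse (X n)) = abs2_rat (X n - X m) / (r * r)"
        using N[of m] N[of n] mn
        by (simp only: abs2_rat_mult abs2_rat_inverse) (simp add: divide_inverse)
      also have "\<dots> < e" using M[of n m] mn r by (simp add: field_simps)
      finally show ?thesis .
    qed
    thus "\<exists>N. \<forall>m\<ge>N. \<forall>n\<ge>N. abs2_rat (inverse (X m) - inverse (X n)) < e" by blast
  qed
qed

lemma null2_diff_inverse:
  assumes "cauchy2 X" "\<not> null2 X" "cauchy2 Y" "\<not> null2 Y" "null2 (\<lambda>n. X n - Y n)"
  shows "null2 (\<lambda>n. inverse (X n) - inverse (Y n))"
proof -
  obtain r where r: "r > 0" and ev: "eventually (\<lambda>n. abs2_rat (X n) = r) sequentially"
    using cauchy2_tendsto[OF assms(1)] assms(2) by auto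
  obtain s where s: "s > 0" and ev': "eventually (\<lambda>n. abs2_rat (Y n) = s) sequentially"
    using cauchy2_tendsto[OF assms(3)] assms(4) by auto
  have "(\<lambda>n. abs2_rat (X n - Y n) * inverse (r * s)) \<longlonglongrightarrow> 0"
    using assms(5) unfolding null2_def by (rule tendsto_mult_left_zero)
  moreover have "eventually (\<lambda>n. abs2_rat (X n - Y n) * inverse (r * s) =
                   abs2_rat (inverse (X n) - inverse (Y n))) sequentially"
    using ev ev'
  proof eventually_elim
    case (elim n)
    hence nz: "X n \<noteq> 0" "Y n \<noteq> 0" using r s by auto
    hence "inverse (X n) - inverse (Y n) = (Y n - X n) * inverse (X n * Y n)"
      by (simp add: field_simps)
    thus ?case using elim
      by (simp only: abs2_rat_mult abs2_rat_inverse abs2_rat_diff_commute[of "Y n"])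
  qed
  ultimately show ?thesis
    unfolding null2_def by (rule Lim_transform_eventually)
qed

definition rel2 :: "(nat \<Rightarrow> rat) \<Rightarrow> (nat \<Rightarrow> rat) \<Rightarrow> bool"
  where "rel2 X Y \<longleftrightarrow> cauchy2 X \<and> cauchy2 Y \<and> null2 (\<lambda>n. X n - Y n)"

lemma rel2_refl: "cauchy2 X \<Longrightarrow> rel2 X X"
  by (simp add: rel2_def)

lemma part_equivp_rel2: "part_equivp rel2"
proof (rule part_equivpI)
  show "\<exists>X. rel2 X X" by (rule exI[of _ "\<lambda>_. 0"]) (simp add: rel2_def)
  show "symp rel2" by (auto simp: symp_def rel2_def intro: null2_swap)
  show "transp rel2" by (auto simp: transp_def rel2_def intro: null2_trans)
qed

quotient_type Q2 = "nat \<Rightarrow> rat" / partial: rel2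
  by (rule part_equivp_rel2)

instantiation Q2 :: field
begin

lift_definition zero_Q2 :: Q2 is "\<lambda>_. 0" by (simp add: rel2_refl)

lift_definition one_Q2 :: Q2 is "\<lambda>_. 1" by (simp add: rel2_refl)

lift_definition plus_Q2 :: "Q2 \<Rightarrow> Q2 \<Rightarrow> Q2" is "\<lambda>X Y n. X n + Y n"
  unfolding rel2_def add_diff_add by (simp add: cauchy2_add null2_add)

lift_definition uminus_Q2 :: "Q2 \<Rightarrow> Q2" is "\<lambda>X n. - X n"
  unfolding rel2_def minus_diff_minus by (simp only: cauchy2_minus null2_minus simp_thms)

lift_definition times_Q2 :: "Q2 \<Rightarrow> Q2 \<Rightarrow> Q2" is "\<lambda>X Y n. X n * Y n"
proof -
  fix X X' Y Y' assume *: "rel2 X X'" "rel2 Y Y'"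
  have "null2 (\<lambda>n. X n * (Y n - Y' n) + Y' n * (X n - X' n))"
    using * by (intro null2_add null2_mult_bounded cauchy2_bounded) (auto simp: rel2_def)
  thus "rel2 (\<lambda>n. X n * Y n) (\<lambda>n. X' n * Y' n)"
    using * by (simp add: rel2_def cauchy2_mult algebra_simps)
qed

lift_definition inverse_Q2 :: "Q2 \<Rightarrow> Q2"
  is "\<lambda>X. if null2 X then (\<lambda>_. 0) else (\<lambda>n. inverse (X n))"
proof -
  fix X Y assume XY: "rel2 X Y"
  have "null2 X \<longleftrightarrow> null2 Y"
    using XY null2_add[of Y "\<lambda>n. X n - Y n"] null2_add[of X "\<lambda>n. Y n - X n"]
    by (auto simp: rel2_def intro: null2_swap)
  thus "rel2 (if null2 X then (\<lambda>_. 0) else (\<lambda>n. inverse (X n)))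
             (if null2 Y then (\<lambda>_. 0) else (\<lambda>n. inverse (Y n)))"
    using XY by (auto simp: rel2_def intro: cauchy2_inverse null2_diff_inverse)
qed

definition "x - y = x + - y" for x y :: Q2

definition "x div y = x * inverse y" for x y :: Q2

instance
proof
  fix a b c :: Q2
  show "a + b + c = a + (b + c)"
    by transfer (simp add: ac_simps rel2_def cauchy2_add)
  show "a + b = b + a"
    by transfer (simp add: ac_simps rel2_def cauchy2_add)
  show "0 + a = a"
    by transfer (simp add: rel2_def)
  show "- a + a = 0"
    by transfer (simp add: rel2_def)
  show "a - b = a + - b"
    by (rule minus_Q2_def)
  show "a * b * c = a * (b * c)"
    by transfer (simp add: ac_simps rel2_def cauchy2_mult)
  show "a * b = b * a"
    by transfer (simp add: ac_simps rel2_def cauchy2_mult)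
  show "1 * a = a"
    by transfer (simp add: rel2_def)
  show "(a + b) * c = a * c + b * c"
    by transfer (simp add: distrib_right rel2_def cauchy2_mult cauchy2_add)
  show "(0::Q2) \<noteq> 1"
    by transfer (simp add: rel2_def)
  have "null2 (\<lambda>n. inverse (X n) * X n - 1)" if X: "cauchy2 X" "\<not> null2 X" for X
  proof -
    obtain r where r: "r > 0" and ev: "eventually (\<lambda>n. abs2_rat (X n) = r) sequentially"
      using cauchy2_tendsto[OF X(1)] X(2) by auto
    have "eventually (\<lambda>n. abs2_rat (inverse (X n) * X n - 1) = 0) sequentially"
      using ev using r
      by (auto elim!: eventually_mono intro!: left_inverse)
    thus ?thesis unfolding null2_def by (rule tendsto_eventually)
  qed
  thus "a \<noteq> 0 \<Longrightarrow> inverse a * a = 1"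
    by transfer (auto simp: rel2_def intro: cauchy2_mult cauchy2_inverse)
  show "a div b = a * inverse b"
    by (rule divide_Q2_def)
  show "inverse (0::Q2) = 0"
    by transfer (simp add: rel2_def)
qed

end

lemma Q2_cases:
  obtains X where "cauchy2 X" "x = abs_Q2 X"
proof -
  have "\<exists>X. cauchy2 X \<and> x = abs_Q2 X"
    by (induction x rule: Q2.abs_induct) (auto simp: rel2_def)
  thus ?thesis using that by blast
qed

lemma abs_Q2_eq_iff:
  "cauchy2 X \<Longrightarrow> cauchy2 Y \<Longrightarrow> abs_Q2 X = abs_Q2 Y \<longleftrightarrow> null2 (\<lambda>n. X n - Y n)"
  using Quotient3_rel[OF Quotient3_Q2, of X Y] by (auto simp: rel2_def)

lemma abs_Q2_add: "cauchy2 X \<Longrightarrow> cauchy2 Y \<Longrightarrow> abs_Q2 X + abs_Q2 Y = abs_Q2 (\<lambda>n. X n + Y n)"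
  by (simp add: plus_Q2.abs_eq rel2_refl)

lemma abs_Q2_minus: "cauchy2 X \<Longrightarrow> - abs_Q2 X = abs_Q2 (\<lambda>n. - X n)"
  by (simp add: uminus_Q2.abs_eq rel2_refl)

lemma abs_Q2_diff: "cauchy2 X \<Longrightarrow> cauchy2 Y \<Longrightarrow> abs_Q2 X - abs_Q2 Y = abs_Q2 (\<lambda>n. X n - Y n)"
  by (simp add: minus_Q2_def abs_Q2_minus abs_Q2_add cauchy2_minus)

lemma abs_Q2_mult: "cauchy2 X \<Longrightarrow> cauchy2 Y \<Longrightarrow> abs_Q2 X * abs_Q2 Y = abs_Q2 (\<lambda>n. X n * Y n)"
  by (simp add: times_Q2.abs_eq rel2_refl)

lemma of_nat_Q2: "of_nat n = abs_Q2 (\<lambda>_. of_nat n)"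
  by (induction n) (simp_all add: zero_Q2_def one_Q2_def abs_Q2_add)

instance Q2 :: field_char_0
  by standard (auto intro!: injI simp: of_nat_Q2 abs_Q2_eq_iff)

lemma of_int_Q2: "of_int k = abs_Q2 (\<lambda>_. of_int k)"
  by (cases k) (simp_all add: of_nat_Q2 abs_Q2_minus one_Q2_def abs_Q2_diff)

lemma of_rat_Q2: "of_rat r = abs_Q2 (\<lambda>_. r)"
proof -
  obtain a b where ab: "b \<noteq> 0" "r = of_int a / of_int b" by (rule rat_quotientE)
  have "abs_Q2 (\<lambda>_. r) * of_int b = of_int a"
    using ab by (simp add: of_int_Q2 abs_Q2_mult)
  moreover have "(of_rat r :: Q2) * of_int b = of_int a"
    using ab by (simp add: of_rat_divide)
  moreover have "(of_int b :: Q2) \<noteq> 0" using ab by simp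
  ultimately show ?thesis by (metis mult_right_cancel)
qed

lift_definition norm2 :: "Q2 \<Rightarrow> real" is "\<lambda>X. lim (\<lambda>n. abs2_rat (X n))"
proof -
  fix X Y assume XY: "rel2 X Y"
  obtain a where a: "(\<lambda>n. abs2_rat (X n)) \<longlonglongrightarrow> a"
    using XY cauchy2_convergent unfolding rel2_def convergent_def by blast
  have "(\<lambda>n. abs2_rat (X n) - abs2_rat (Y n)) \<longlonglongrightarrow> 0"
    by (rule Lim_null_comparison[of _ "\<lambda>n. abs2_rat (X n - Y n)"])
       (use XY in \<open>auto simp: rel2_def null2_def abs2_rat_diff_abs\<close>)
  from tendsto_diff[OF a this] have "(\<lambda>n. abs2_rat (Y n)) \<longlonglongrightarrow> a" by simp
  thus "lim (\<lambda>n. abs2_rat (X n)) = lim (\<lambda>n. abs2_rat (Y n))"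
    using a by (simp add: limI)
qed

lemma tendsto_norm2: "cauchy2 X \<Longrightarrow> (\<lambda>n. abs2_rat (X n)) \<longlonglongrightarrow> norm2 (abs_Q2 X)"
  using cauchy2_convergent by (simp add: norm2.abs_eq rel2_refl convergent_LIMSEQ_iff)

lemma norm_of_rat_Q2 [simp]: "norm2 (of_rat r :: Q2) = abs2_rat r"
  using tendsto_norm2[of "\<lambda>_. r"] by (simp add: of_rat_Q2 LIMSEQ_const_iff)

lemma norm2_0 [simp]: "norm2 (0 :: Q2) = 0"
  using norm_of_rat_Q2[of 0] by simp

lemma norm2_1 [simp]: "norm2 (1 :: Q2) = 1"
  using norm_of_rat_Q2[of 1] by simp

lemma norm2_nonneg [simp]: "norm2 (x :: Q2) \<ge> 0"
proof -
  obtain X where X: "cauchy2 X" "x = abs_Q2 X" by (rule Q2_cases)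
  show ?thesis
    unfolding X(2) by (rule LIMSEQ_le_const[OF tendsto_norm2[OF X(1)]]) auto
qed

lemma norm2_eq_0_iff [simp]: "norm2 (x :: Q2) = 0 \<longleftrightarrow> x = 0"
proof
  obtain X where X: "cauchy2 X" "x = abs_Q2 X" by (rule Q2_cases)
  assume "norm2 x = 0"
  hence "null2 X" using tendsto_norm2[OF X(1)] X(2) by (simp add: null2_def)
  thus "x = 0" using X by (simp add: zero_Q2_def abs_Q2_eq_iff)
qed simp

lemma norm2_mult: "norm2 (x * y) = norm2 x * norm2 (y :: Q2)"
proof -
  obtain X where X: "cauchy2 X" "x = abs_Q2 X" by (rule Q2_cases)
  obtain Y where Y: "cauchy2 Y" "y = abs_Q2 Y" by (rule Q2_cases)
  have "(\<lambda>n. abs2_rat (X n) * abs2_rat (Y n)) \<longlonglongrightarrow> norm2 (x * y)"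
    using tendsto_norm2[OF cauchy2_mult[OF X(1) Y(1)]] X Y
    by (simp add: abs_Q2_mult abs2_rat_mult)
  moreover have "(\<lambda>n. abs2_rat (X n) * abs2_rat (Y n)) \<longlonglongrightarrow> norm2 x * norm2 y"
    unfolding X(2) Y(2) by (intro tendsto_mult tendsto_norm2 X(1) Y(1))
  ultimately show ?thesis by (rule LIMSEQ_unique)
qed

lemma norm2_ultrametric: "norm2 (x + y) \<le> max (norm2 x) (norm2 (y :: Q2))"
proof -
  obtain X where X: "cauchy2 X" "x = abs_Q2 X" by (rule Q2_cases)
  obtain Y where Y: "cauchy2 Y" "y = abs_Q2 Y" by (rule Q2_cases)
  have "(\<lambda>n. abs2_rat (X n + Y n)) \<longlonglongrightarrow> norm2 (x + y)"
    using tendsto_norm2[OF cauchy2_add[OF X(1) Y(1)]] X Y by (simp add: abs_Q2_add)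
  moreover have "(\<lambda>n. max (abs2_rat (X n)) (abs2_rat (Y n))) \<longlonglongrightarrow> max (norm2 x) (norm2 y)"
    unfolding X(2) Y(2) by (intro tendsto_max tendsto_norm2 X(1) Y(1))
  ultimately show ?thesis
    by (rule LIMSEQ_le) (simp add: abs2_rat_ultrametric)
qed

lemma norm2_minus [simp]: "norm2 (- x :: Q2) = norm2 x"
  using norm2_mult[of "of_rat (-1)" x] unfolding norm_of_rat_Q2 by (simp add: of_rat_minus)

lemma norm2_minus_commute: "norm2 (x - y :: Q2) = norm2 (y - x)"
  by (metis norm2_minus minus_diff_eq)

lemma norm2_ultrametric_diff: "norm2 (x - z :: Q2) \<le> max (norm2 (x - y)) (norm2 (y - z))"
  using norm2_ultrametric[of "x - y" "y - z"] by simp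

lemma norm2_isosceles: "norm2 (x - y :: Q2) < norm2 y \<Longrightarrow> norm2 x = norm2 y"
  using norm2_ultrametric[of "x - y" y] norm2_ultrametric[of "y - x" x]
  by (auto simp: norm2_minus_commute[of y x] max_def split: if_splits)

lemma norm2_inverse: "norm2 (inverse x :: Q2) = inverse (norm2 x)"
proof (cases "x = 0")
  case False
  hence "norm2 x * norm2 (inverse x) = 1"
    by (metis norm2_mult norm2_1 right_inverse)
  thus ?thesis by (metis inverse_unique)
qed simp

lemma norm2_divide: "norm2 (x / y :: Q2) = norm2 x / norm2 y"
  by (simp add: divide_inverse norm2_mult norm2_inverse)

lemma norm2_2 [simp]: "norm2 (2 :: Q2) = 1 / 2"
  using norm_of_rat_Q2[of 2] by (simp add: abs2_rat_2)

lemma norm2_power: "norm2 (x ^ n :: Q2) = norm2 x ^ n"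
  by (induction n) (simp_all add: norm2_mult)

lemma norm2_powi: "norm2 (x powi k :: Q2) = norm2 x powi k"
  by (simp add: power_int_def norm2_power norm2_inverse)

instantiation Q2 :: metric_space
begin

definition dist_Q2 :: "Q2 \<Rightarrow> Q2 \<Rightarrow> real"
  where "dist_Q2 x y = norm2 (x - y)"

definition uniformity_Q2 :: "(Q2 \<times> Q2) filter"
  where "uniformity_Q2 = (INF e\<in>{0 <..}. principal {(x, y). dist x y < e})"

definition open_Q2 :: "Q2 set \<Rightarrow> bool"
  where "open_Q2 U \<longleftrightarrow> (\<forall>x\<in>U. eventually (\<lambda>(x', y). x' = x \<longrightarrow> y \<in> U) uniformity)"

instance
proof
  fix x y z :: Q2
  show "dist x y = 0 \<longleftrightarrow> x = y"
    by (simp add: dist_Q2_def)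
  have "dist x y \<le> max (dist x z) (dist z y)"
    unfolding dist_Q2_def by (rule norm2_ultrametric_diff)
  also have "\<dots> \<le> dist x z + dist y z"
    by (simp add: dist_Q2_def norm2_minus_commute[of z y])
  finally show "dist x y \<le> dist x z + dist y z" .
qed (simp_all add: uniformity_Q2_def open_Q2_def)

end

lemma dist_Q2_ultrametric: "dist x z \<le> max (dist x y) (dist y (z :: Q2))"
  unfolding dist_Q2_def by (rule norm2_ultrametric_diff)

instance Q2 :: topological_ab_group_add
proof
  fix a b :: Q2
  show "((\<lambda>x. fst x + snd x) \<longlongrightarrow> a + b) (nhds a \<times>\<^sub>F nhds b)"
  proof (rule tendstoI)
    fix e :: real assume e: "e > 0"
    have "eventually (\<lambda>x. dist x a < e) (nhds a)" "eventually (\<lambda>y. dist y b < e) (nhds b)"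
      using e by (auto simp: eventually_nhds_metric)
    hence "eventually (\<lambda>x. dist (fst x) a < e \<and> dist (snd x) b < e) (nhds a \<times>\<^sub>F nhds b)"
      by (auto simp: eventually_prod_filter)
    thus "eventually (\<lambda>x. dist (fst x + snd x) (a + b) < e) (nhds a \<times>\<^sub>F nhds b)"
    proof eventually_elim
      case (elim x)
      have "fst x + snd x - (a + b) = (fst x - a) + (snd x - b)" by simp
      thus ?case using norm2_ultrametric[of "fst x - a" "snd x - b"] elim
        by (simp only: dist_Q2_def) auto
    qed
  qed
  show "(uminus \<longlongrightarrow> - a) (nhds a)"
  proof (rule tendstoI)
    fix e :: real assume "e > 0"
    hence "eventually (\<lambda>x. dist x a < e) (nhds a)"
      by (auto simp: eventually_nhds_metric)
    moreover have "dist (- x) (- a) = dist x a" for x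
      by (simp add: dist_Q2_def norm2_minus_commute[of a x])
    ultimately show "eventually (\<lambda>x. dist (- x) (- a) < e) (nhds a)" by simp
  qed
qed

lemma cauchy2_LIMSEQ:
  assumes "cauchy2 X"
  shows "(\<lambda>n. of_rat (X n)) \<longlonglongrightarrow> abs_Q2 X"
proof (rule metric_LIMSEQ_I)
  fix e :: real assume e: "e > 0"
  obtain N where N: "abs2_rat (X m - X n) < e / 2" if "m \<ge> N" "n \<ge> N" for m n
    using assms e unfolding cauchy2_def by (meson half_gt_zero)
  have "dist (of_rat (X n)) (abs_Q2 X) < e" if n: "n \<ge> N" for n
  proof -
    have "cauchy2 (\<lambda>m. X n - X m)"
      using cauchy2_add[OF cauchy2_const cauchy2_minus[OF assms]] by simp
    hence "(\<lambda>m. abs2_rat (X n - X m)) \<longlonglongrightarrow> dist (of_rat (X n)) (abs_Q2 X)"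
      using tendsto_norm2[of "\<lambda>m. X n - X m"] assms
      by (simp add: dist_Q2_def of_rat_Q2 abs_Q2_diff)
    hence "dist (of_rat (X n)) (abs_Q2 X) \<le> e / 2"
      by (rule LIMSEQ_le_const2) (use N[of n] n less_imp_le in blast)
    thus ?thesis using e by simp
  qed
  thus "\<exists>N. \<forall>n\<ge>N. dist (of_rat (X n)) (abs_Q2 X) < e" by blast
qed

lemma of_rat_dense_Q2:
  assumes "e > 0"
  obtains q where "dist (x :: Q2) (of_rat q) < e"
proof -
  obtain X where X: "cauchy2 X" "x = abs_Q2 X" by (rule Q2_cases)
  obtain N where "dist (of_rat (X N)) x < e"
    using metric_LIMSEQ_D[OF cauchy2_LIMSEQ[OF X(1)] assms] X(2) by blast
  thus ?thesis using that[of "X N"] by (simp add: dist_commute)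
qed

instance Q2 :: complete_space
proof
  fix S :: "nat \<Rightarrow> Q2" assume S: "Cauchy S"
  have "\<exists>q. dist (S n) (of_rat q) < 1 / real (Suc n)" for n
    by (rule of_rat_dense_Q2[of "1 / real (Suc n)" "S n"]) auto
  then obtain q where q: "\<And>n. dist (S n) (of_rat (q n)) < 1 / real (Suc n)" by metis
  have lim: "(\<lambda>n. dist (S n) (of_rat (q n))) \<longlonglongrightarrow> 0"
    by (rule tendsto_sandwich[OF _ _ tendsto_const LIMSEQ_Suc[OF lim_1_over_n]])
       (use q less_imp_le in \<open>auto intro!: always_eventually\<close>)
  have "cauchy2 q"
    unfolding cauchy2_def
  proof (intro allI impI)
    fix e :: real assume e: "e > 0"
    obtain M where M: "dist (S n) (of_rat (q n)) < e" if "n \<ge> M" for n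
      using order_tendstoD(2)[OF lim e] by (auto simp: eventually_sequentially)
    obtain N where N: "dist (S m) (S n) < e" if "m \<ge> N" "n \<ge> N" for m n
      using S e unfolding Cauchy_def by blast
    have "abs2_rat (q m - q n) < e" if mn: "m \<ge> max M N" "n \<ge> max M N" for m n
    proof -
      have "dist (of_rat (q m) :: Q2) (of_rat (q n)) < e"
        using dist_Q2_ultrametric[of "of_rat (q m)" "of_rat (q n)" "S m"]
              dist_Q2_ultrametric[of "S m" "of_rat (q n)" "S n"] M[of m] M[of n] N[of m n] mn
        by (auto simp: dist_commute)
      thus ?thesis by (simp add: dist_Q2_def flip: of_rat_diff)
    qed
    thus "\<exists>N. \<forall>m\<ge>N. \<forall>n\<ge>N. abs2_rat (q m - q n) < e" by blast
  qed
  hence "(\<lambda>n. of_rat (q n)) \<longlonglongrightarrow> abs_Q2 q" by (rule cauchy2_LIMSEQ)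
  hence "(\<lambda>n. dist (of_rat (q n)) (abs_Q2 q)) \<longlonglongrightarrow> 0"
    by (simp only: tendsto_dist_iff[of _ "abs_Q2 q"])
  with lim have "(\<lambda>n. dist (S n) (of_rat (q n)) + dist (of_rat (q n)) (abs_Q2 q)) \<longlonglongrightarrow> 0"
    by (rule tendsto_add_zero)
  hence "(\<lambda>n. dist (S n) (abs_Q2 q)) \<longlonglongrightarrow> 0"
    by (rule tendsto_sandwich[OF _ _ tendsto_const, rotated 2])
       (auto intro!: always_eventually dist_triangle)
  hence "S \<longlonglongrightarrow> abs_Q2 q"
    by (simp only: tendsto_dist_iff[of _ "abs_Q2 q"])
  thus "convergent S" by (auto simp: convergent_def)
qed

lemma norm2_cases:
  fixes x :: Q2
  assumes "x \<noteq> 0"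
  obtains k where "norm2 x = 2 powi k"
proof -
  have "norm2 x > 0"
    using assms norm2_nonneg[of x] by (simp add: order_less_le eq_commute[of 0])
  then obtain q where "dist x (of_rat q) < norm2 x" by (rule of_rat_dense_Q2)
  hence *: "norm2 x = norm2 (of_rat q :: Q2)"
    using norm2_isosceles[of "of_rat q" x]
    by (simp add: dist_Q2_def norm2_minus_commute[of "of_rat q" x])
  moreover have "q \<noteq> 0" using * assms by auto
  ultimately show ?thesis using that by (auto simp: abs2_rat_def)
qed

lemma norm2_parity:
  assumes "norm2 (x :: Q2) \<le> 1"
  shows "norm2 x \<le> 1/2 \<or> norm2 (x - 1) \<le> 1/2"
proof -
  obtain q where q: "dist x (of_rat q) < 1/2" using of_rat_dense_Q2[of "1/2" x] by auto
  have "norm2 (of_rat q :: Q2) \<le> 1"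
    using norm2_ultrametric_diff[of "of_rat q" 0 x] q assms
    by (simp add: dist_Q2_def norm2_minus_commute[of "of_rat q" x])
  hence "norm2 (of_rat q :: Q2) \<le> 1/2 \<or> norm2 (of_rat q - 1 :: Q2) \<le> 1/2"
    using abs2_rat_parity[of q] norm_of_rat_Q2[of "q - 1"] by (simp add: of_rat_diff)
  thus ?thesis
    using norm2_ultrametric_diff[of x 0 "of_rat q"] norm2_ultrametric_diff[of x 1 "of_rat q"] q
    by (auto simp: dist_Q2_def)
qed

lemma powi_small:
  assumes "e > (0::real)"
  obtains n :: nat where "2 powi (- int n) < e"
  using real_arch_pow_inv[OF assms, of "1/2"] by (auto simp: power_int_minus power_one_over field_simps)

lemma cball_Q2_eq: "y \<in> cball x r \<Longrightarrow> cball y r = cball (x :: Q2) r"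
proof -
  assume "y \<in> cball x r"
  hence "dist y z \<le> r \<longleftrightarrow> dist x z \<le> r" for z
    using dist_Q2_ultrametric[of x z y] dist_Q2_ultrametric[of y z x]
    by (auto simp: dist_commute[of y x])
  thus ?thesis by auto
qed

lemma open_cball_Q2: "r > 0 \<Longrightarrow> open (cball (x :: Q2) r)"
  unfolding open_contains_ball using ball_subset_cball cball_Q2_eq by blast

definition balls2 :: "Q2 set set"
  where "balls2 = insert {} (range (\<lambda>(q, k). cball (of_rat q) (2 powi k)))"

lemma balls2E:
  assumes "B \<in> balls2"
  obtains "B = {}" | q k where "B = cball (of_rat q) (2 powi k)"
  using assms by (auto simp: balls2_def)

lemma countable_balls2: "countable balls2"
  by (simp add: balls2_def)

lemma topological_basis_balls2: "topological_basis balls2"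
proof (rule topological_basisI)
  fix B assume "B \<in> balls2"
  thus "open B" by (auto elim!: balls2E intro: open_cball_Q2)
next
  fix U :: "Q2 set" and x assume "open U" "x \<in> U"
  then obtain e where e: "e > 0" "ball x e \<subseteq> U" by (meson openE)
  obtain n :: nat where n: "2 powi (- int n) < e" using e(1) by (rule powi_small)
  obtain q where q: "dist x (of_rat q) < 2 powi (- int n)"
    by (rule of_rat_dense_Q2[of "2 powi (- int n)" x]) auto
  hence x: "x \<in> cball (of_rat q) (2 powi (- int n))" by (simp add: dist_commute)
  have "cball (of_rat q) (2 powi (- int n)) = cball x (2 powi (- int n))"
    using cball_Q2_eq[OF x] by simp
  also have "\<dots> \<subseteq> ball x e" using n by auto
  finally have "cball (of_rat q) (2 powi (- int n)) \<subseteq> U" using e by blast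
  moreover have "cball (of_rat q) (2 powi (- int n)) \<in> balls2"
    unfolding balls2_def by auto
  ultimately show "\<exists>B\<in>balls2. x \<in> B \<and> B \<subseteq> U" using x by blast
qed

instance Q2 :: second_countable_topology
  by standard (rule exI[of _ balls2], rule conjI[OF countable_balls2 topological_basis_imp_subbasis[OF topological_basis_balls2]])

lemma borel_Q2_eq: "(borel :: Q2 measure) = sigma UNIV balls2"
  by (rule borel_eq_countable_basis[OF countable_balls2 topological_basis_balls2])

lemma Int_stable_balls2: "Int_stable balls2"
proof (rule Int_stableI)
  fix A B assume AB: "A \<in> balls2" "B \<in> balls2"
  show "A \<inter> B \<in> balls2"
  proof (cases "A \<inter> B = {}")
    case False
    then obtain y where y: "y \<in> A" "y \<in> B" by blast
    obtain q k where A: "A = cball (of_rat q) (2 powi k)" using AB(1) y by (auto elim: balls2E)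
    obtain r l where B: "B = cball (of_rat r) (2 powi l)" using AB(2) y by (auto elim: balls2E)
    have "A = cball y (2 powi k)" "B = cball y (2 powi l)"
      using y cball_Q2_eq unfolding A B by blast+
    hence "A \<subseteq> B \<or> B \<subseteq> A"
      by (metis linorder_le_cases subset_cball)
    thus ?thesis using AB by (metis inf.absorb1 inf.absorb2)
  qed (auto simp: balls2_def)
qed

lemma measure_Q2_eqI:
  fixes M N :: "Q2 measure"
  assumes "sets M = sets borel" "sets N = sets borel"
    and M: "\<And>a k. emeasure M (cball a (2 powi k)) = ennreal (2 powi k)"
    and N: "\<And>a k. emeasure N (cball a (2 powi k)) = ennreal (2 powi k)"
  shows "M = N"
proof (rule measure_eqI_generator_eq[of balls2 UNIV _ _ "\<lambda>n. cball 0 (2 powi int n)"])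
  show "emeasure M X = emeasure N X" if "X \<in> balls2" for X
    using that by (auto elim!: balls2E simp: M N)
  show "sets M = sigma_sets UNIV balls2" "sets N = sigma_sets UNIV balls2"
    using assms(1,2) by (simp_all add: borel_Q2_eq)
  have "cball 0 (2 powi int n) \<in> balls2" for n
    unfolding balls2_def by (rule insertI2, rule range_eqI[of _ _ "(0, int n)"]) simp
  thus "range (\<lambda>n. cball 0 (2 powi int n)) \<subseteq> balls2" by blast
  have "x \<in> (\<Union>n. cball 0 (2 powi int n))" for x :: Q2
    using real_arch_pow[of 2 "dist 0 x"] by (auto intro: less_imp_le)
  thus "(\<Union>n. cball (0 :: Q2) (2 powi int n)) = UNIV" by blast
  show "emeasure M (cball 0 (2 powi int n)) \<noteq> \<infinity>" for n
    by (simp only: M) simp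
qed (auto simp: Int_stable_balls2)

text \<open>
  \<open>Z2\<close> is given by digit expansions; it is the closed unit ball by \<open>Z2_eq\<close>.
\<close>

definition Z2 :: "Q2 set"
  where "Z2 = {x. \<exists>c :: nat \<Rightarrow> Q2. (\<forall>i. c i \<in> {0, 1}) \<and> (\<lambda>i. c i * 2 ^ i) sums x}"

lemma Z2_eq: "Z2 = cball 0 1"
proof (intro equalityI subsetI)
  fix x assume "x \<in> Z2"
  then obtain c :: "nat \<Rightarrow> Q2"
    where c: "\<And>i. c i \<in> {0, 1}" and s: "(\<lambda>i. c i * 2 ^ i) sums x"
    unfolding Z2_def by blast
  have "norm2 (\<Sum>i<n. c i * 2 ^ i) \<le> 1" for n
  proof (induction n)
    case (Suc n)
    have "norm2 (c n * 2 ^ n) \<le> 1"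
      using c[of n] by (auto simp: norm2_power power_le_one)
    thus ?case
      using Suc norm2_ultrametric[of "\<Sum>i<n. c i * 2 ^ i" "c n * 2 ^ n"] by simp
  qed simp
  hence "(\<Sum>i<n. c i * 2 ^ i) \<in> cball 0 1" for n by (simp add: dist_Q2_def)
  moreover have "(\<lambda>n. \<Sum>i<n. c i * 2 ^ i) \<longlonglongrightarrow> x"
    using s by (simp add: sums_def)
  ultimately show "x \<in> cball 0 1"
    by (rule closed_sequentially[OF closed_cball])
next
  fix a :: Q2 assume "a \<in> cball 0 1"
  hence a: "norm2 a \<le> 1" by (simp add: dist_Q2_def)
  define dig :: "Q2 \<Rightarrow> Q2" where "dig y = (if norm2 y \<le> 1/2 then 0 else 1)" for y
  define A where "A = rec_nat a (\<lambda>_ y. (y - dig y) / 2)"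
  have A0: "A 0 = a" and AS: "A (Suc n) = (A n - dig (A n)) / 2" for n
    by (simp_all add: A_def)
  have A: "norm2 (A n) \<le> 1" for n
  proof (induction n)
    case (Suc n)
    thus ?case using norm2_parity[of "A n"] by (auto simp: AS dig_def norm2_divide)
  qed (simp add: A0 a)
  have eq: "a = (\<Sum>i<n. dig (A i) * 2 ^ i) + 2 ^ n * A n" for n
    by (induction n) (simp_all add: A0 AS field_simps)
  have "dist (\<Sum>i<n. dig (A i) * 2 ^ i) a \<le> (1 / 2) ^ n" for n
  proof -
    have "dist (\<Sum>i<n. dig (A i) * 2 ^ i) a = norm2 (2 ^ n * A n)"
      by (subst eq[of n]) (simp add: dist_Q2_def)
    also have "\<dots> \<le> (1 / 2) ^ n"
      using A[of n] by (simp add: norm2_mult norm2_power mult_left_le)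
    finally show ?thesis .
  qed
  hence "(\<lambda>n. dist (\<Sum>i<n. dig (A i) * 2 ^ i) a) \<longlonglongrightarrow> 0"
    by (intro tendsto_sandwich[OF _ _ tendsto_const LIMSEQ_power_zero[of "1 / 2 :: real"]])
       (auto intro!: always_eventually)
  hence "(\<lambda>i. dig (A i) * 2 ^ i) sums a"
    unfolding sums_def by (simp only: tendsto_dist_iff[of _ a])
  thus "a \<in> Z2"
    unfolding Z2_def mem_Collect_eq
    by (intro exI[of _ "\<lambda>i. dig (A i)"] conjI allI) (simp_all add: dig_def)
qed

lemma scale_Z2: "(\<lambda>x. 2 powi l * x) ` Z2 = cball 0 (2 powi (- l))"
proof (intro equalityI subsetI)
  fix x assume "x \<in> (\<lambda>x. 2 powi l * x) ` Z2"
  thus "x \<in> cball 0 (2 powi (- l))"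
    by (auto simp: Z2_eq dist_Q2_def norm2_mult norm2_powi norm2_divide power_int_minus
          power_int_divide_distrib field_simps)
next
  fix x :: Q2 assume "x \<in> cball 0 (2 powi (- l))"
  hence "2 powi (- l) * x \<in> Z2"
    by (auto simp: Z2_eq dist_Q2_def norm2_mult norm2_powi norm2_divide power_int_minus
          power_int_divide_distrib field_simps)
  moreover have "x = 2 powi l * (2 powi (- l) * x)"
    by (simp add: power_int_minus)
  ultimately show "x \<in> (\<lambda>x. 2 powi l * x) ` Z2" by blast
qed

text \<open>
  These conditions have exactly one solution (\<open>haar_Q2_exists\<close> and \<open>haar_Q2_unique\<close> below).
\<close>

definition haar_Q2 :: "Q2 measure \<Rightarrow> bool"
  where "haar_Q2 M \<longleftrightarrow>
    sets M = sets borel \<and>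
    (\<forall>a. \<forall>A\<in>sets borel. emeasure M ((\<lambda>x. a + x) ` A) = emeasure M A) \<and>
    (\<forall>l::int. emeasure M ((\<lambda>x. 2 powi l * x) ` Z2) = ennreal (2 powi (- l)))"

lemma translate_cball_Q2: "(\<lambda>x. a + x) ` cball b r = cball (a + b :: Q2) r"
proof (intro equalityI subsetI)
  fix x assume "x \<in> cball (a + b) r"
  thus "x \<in> (\<lambda>x. a + x) ` cball b r"
    by (intro image_eqI[of _ _ "x - a"]) (auto simp: dist_Q2_def algebra_simps)
qed (auto simp: dist_Q2_def)

lemma haar_Q2_cball:
  assumes "haar_Q2 M"
  shows "emeasure M (cball a (2 powi k)) = ennreal (2 powi k)"
proof -
  have "emeasure M (cball a (2 powi k)) = emeasure M ((\<lambda>x. a + x) ` cball 0 (2 powi k))"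
    by (simp add: translate_cball_Q2)
  also have "\<dots> = emeasure M (cball 0 (2 powi k))"
    using assms by (simp add: haar_Q2_def)
  also have "\<dots> = emeasure M ((\<lambda>x. 2 powi (- k) * x) ` Z2)"
    by (simp add: scale_Z2)
  also have "\<dots> = ennreal (2 powi k)"
    using assms by (simp add: haar_Q2_def del: power_int_minus)
  finally show ?thesis .
qed

lemma haar_Q2_iff:
  "haar_Q2 M \<longleftrightarrow>
     sets M = sets borel \<and> (\<forall>a k. emeasure M (cball a (2 powi k)) = ennreal (2 powi k))"
proof safe
  assume M: "sets M = sets borel" "\<forall>a k. emeasure M (cball a (2 powi k)) = ennreal (2 powi k)"
  have sp: "space M = UNIV" using sets_eq_imp_space_eq[OF M(1)] by simp
  have "emeasure M ((\<lambda>x. a + x) ` A) = emeasure M A" if A: "A \<in> sets borel" for a A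
  proof -
    have meas: "(\<lambda>x. x - a) \<in> M \<rightarrow>\<^sub>M borel"
      unfolding measurable_cong_sets[OF M(1) refl]
      by (intro borel_measurable_continuous_onI continuous_intros)
    have vim: "(\<lambda>x. x - a) -` B \<inter> space M = (\<lambda>x. a + x) ` B" for B
      by (auto simp: sp intro!: image_eqI[of _ _ "_ - a"])
    have distr: "emeasure (distr M borel (\<lambda>x. x - a)) B = emeasure M ((\<lambda>x. a + x) ` B)"
      if "B \<in> sets borel" for B
      using that by (simp add: emeasure_distr[OF meas] vim)
    have "distr M borel (\<lambda>x. x - a) = M"
      by (rule measure_Q2_eqI) (simp_all add: M distr translate_cball_Q2)
    thus ?thesis using distr[OF A] by simp
  qed
  thus "haar_Q2 M"
    unfolding haar_Q2_def using M by (auto simp: scale_Z2 simp del: power_int_minus)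
next
  assume "haar_Q2 M"
  thus "emeasure M (cball a (2 powi k)) = ennreal (2 powi k)" for a k
    by (rule haar_Q2_cball)
qed (auto simp: haar_Q2_def)

lemma haar_Q2_unique: "haar_Q2 M \<Longrightarrow> haar_Q2 N \<Longrightarrow> M = N"
  by (rule measure_Q2_eqI) (auto simp: haar_Q2_iff)

text \<open>
  Existence: bit reversal maps the half line with Lebesgue measure onto \<open>Q2\<close>
  such that preimages of balls are dyadic intervals of length equal to the radius.
\<close>

fun bitrev :: "nat \<Rightarrow> Q2"
  where "bitrev n = (if n = 0 then 0 else (bitrev (n div 2) + of_nat (n mod 2)) / 2)"

declare bitrev.simps [simp del]

lemma bitrev_0 [simp]: "bitrev 0 = 0"
  by (simp add: bitrev.simps)

lemma bitrev_rec: "bitrev n = (bitrev (n div 2) + of_nat (n mod 2)) / 2"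
  by (cases "n = 0") (simp_all add: bitrev.simps[of n])

lemma norm2_bit: "norm2 (of_nat (n mod 2) :: Q2) \<le> 1"
  by (cases "even n") (auto simp: mod2_eq_if)

lemma bitrev_inj: "norm2 (bitrev m - bitrev n) \<le> 1 \<Longrightarrow> m = n"
proof (induction "m + n" arbitrary: m n rule: less_induct)
  case less
  show ?case
  proof (cases "m = 0 \<and> n = 0")
    case False
    define m' n' where "m' = m div 2" and "n' = n div 2"
    define b c :: Q2 where "b = of_nat (m mod 2)" and "c = of_nat (n mod 2)"
    have eq: "bitrev m - bitrev n = ((bitrev m' - bitrev n') + (b - c)) / 2"
      by (simp add: bitrev_rec[of m] bitrev_rec[of n] m'_def n'_def b_def c_def field_simps)
    have half: "norm2 ((bitrev m' - bitrev n') + (b - c)) \<le> 1/2"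
      using less.prems unfolding eq by (simp add: norm2_divide)
    have bc: "norm2 (b - c) \<le> 1"
      using norm2_ultrametric[of b "-c"] norm2_bit[of m] norm2_bit[of n]
      by (simp add: b_def c_def)
    have "norm2 (bitrev m' - bitrev n') \<le> 1"
      using norm2_ultrametric[of "(bitrev m' - bitrev n') + (b - c)" "c - b"] half bc
      by (simp add: norm2_minus_commute[of c b])
    moreover have "m' + n' < m + n" using False by (auto simp: m'_def n'_def)
    ultimately have mn: "m' = n'" using less.hyps by blast
    hence "norm2 (b - c) \<le> 1/2" using half by simp
    hence "m mod 2 = n mod 2"
      using norm2_minus[of 1] by (auto simp: b_def c_def mod2_eq_if split: if_splits)
    thus "m = n" using mn unfolding m'_def n'_def by (metis div_mult_mod_eq)
  qed auto
qed

lemma bitrev_surj: "norm2 a \<le> 2 ^ k \<Longrightarrow> \<exists>n. norm2 (a - bitrev n) \<le> 1"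
proof (induction k arbitrary: a)
  case 0
  thus ?case by (intro exI[of _ 0]) simp
next
  case (Suc k)
  hence "norm2 (2 * a) \<le> 2 ^ k" by (simp add: norm2_mult)
  then obtain n where n: "norm2 (2 * a - bitrev n) \<le> 1" using Suc.IH by blast
  have "\<exists>b<2. norm2 (2 * a - bitrev n - of_nat b) \<le> 1/2"
    using norm2_parity[OF n]
  proof
    assume "norm2 (2 * a - bitrev n) \<le> 1/2"
    thus ?thesis by (intro exI[of _ 0]) simp
  next
    assume "norm2 (2 * a - bitrev n - 1) \<le> 1/2"
    thus ?thesis by (intro exI[of _ 1]) simp
  qed
  then obtain b :: nat where b: "b < 2" "norm2 (2 * a - bitrev n - of_nat b) \<le> 1/2"
    by blast
  have "bitrev (2 * n + b) = (bitrev n + of_nat b) / 2"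
    using b(1) by (subst bitrev_rec) simp
  hence eq: "a - bitrev (2 * n + b) = (2 * a - bitrev n - of_nat b) / 2"
    by (simp add: field_simps)
  have "norm2 (a - bitrev (2 * n + b)) \<le> 1"
    using b(2) unfolding eq norm2_divide by simp
  thus ?case by blast
qed

lemma norm2_powi2_mult: "norm2 (2 powi k * x) = 2 powi (- k) * norm2 x"
  by (simp add: norm2_mult norm2_powi power_int_divide_distrib power_int_minus field_simps)

definition trunc2 :: "int \<Rightarrow> real \<Rightarrow> Q2"
  where "trunc2 k x = 2 powi k * bitrev (nat \<lfloor>2 powi k * x\<rfloor>)"

lemma trunc2_step: "norm2 (trunc2 (k + 1) x - trunc2 k x) \<le> 2 powi (- k)"
proof -
  define y where "y = 2 powi k * x"
  have y2: "2 powi (k + 1) * x = 2 * y" by (simp add: y_def power_int_add)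
  have "\<lfloor>2 * y\<rfloor> div 2 = \<lfloor>y\<rfloor>"
    using floor_divide_real_eq_div[of 2 "2 * y"] by simp
  hence div: "nat \<lfloor>2 * y\<rfloor> div 2 = nat \<lfloor>y\<rfloor>"
    by (metis nat_div_distrib' nat_numeral zero_le_numeral)
  have "trunc2 (k + 1) x = 2 powi k * (bitrev (nat \<lfloor>y\<rfloor>) + of_nat (nat \<lfloor>2 * y\<rfloor> mod 2))"
    unfolding trunc2_def y2 by (subst bitrev_rec) (simp add: div power_int_add)
  hence "trunc2 (k + 1) x - trunc2 k x = 2 powi k * of_nat (nat \<lfloor>2 * y\<rfloor> mod 2)"
    by (simp add: trunc2_def y_def algebra_simps)
  thus ?thesis
    using norm2_bit[of "nat \<lfloor>2 * y\<rfloor>"]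
    by (simp add: norm2_mult norm2_powi power_int_divide_distrib power_int_minus field_simps)
qed

lemma trunc2_diff: "norm2 (trunc2 (k + int n) x - trunc2 k x) \<le> 2 powi (- k)"
proof (induction n)
  case (Suc n)
  have "norm2 (trunc2 (k + int n + 1) x - trunc2 (k + int n) x) \<le> 2 powi (- (k + int n))"
    by (rule trunc2_step)
  also have "(2::real) powi (- (k + int n)) \<le> 2 powi (- k)"
    by (intro power_int_increasing) auto
  finally show ?case
    using Suc norm2_ultrametric_diff[of "trunc2 (k + int n + 1) x" "trunc2 k x" "trunc2 (k + int n) x"]
    by (simp add: add_ac)
qed simp

lemma trunc2_diff': "k \<le> m \<Longrightarrow> norm2 (trunc2 m x - trunc2 k x) \<le> 2 powi (- k)"
  using trunc2_diff[of k "nat (m - k)" x] by simp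

definition monna :: "real \<Rightarrow> Q2"
  where "monna x = lim (\<lambda>n. trunc2 (int n) x)"

lemma monna_LIMSEQ: "(\<lambda>n. trunc2 (int n) x) \<longlonglongrightarrow> monna x"
proof -
  have "Cauchy (\<lambda>n. trunc2 (int n) x)"
    unfolding Cauchy_altdef2
  proof (intro allI impI)
    fix e :: real assume "e > 0"
    then obtain N :: nat where N: "2 powi (- int N) < e" by (rule powi_small)
    have "dist (trunc2 (int n) x) (trunc2 (int N) x) < e" if "n \<ge> N" for n
      using trunc2_diff'[of "int N" "int n" x] that N by (simp add: dist_Q2_def)
    thus "\<exists>N. \<forall>n\<ge>N. dist (trunc2 (int n) x) (trunc2 (int N) x) < e" by blast
  qed
  thus ?thesis
    unfolding monna_def by (simp add: Cauchy_convergent convergent_LIMSEQ_iff[symmetric])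
qed

lemma monna_trunc2: "norm2 (monna x - trunc2 k x) \<le> 2 powi (- k)"
proof -
  have "eventually (\<lambda>n. trunc2 (int n) x \<in> cball (trunc2 k x) (2 powi (- k))) sequentially"
    using eventually_ge_at_top[of "nat k"]
  proof eventually_elim
    case (elim n)
    thus ?case using trunc2_diff'[of k "int n" x]
      by (simp add: dist_Q2_def norm2_minus_commute[of "trunc2 k x"])
  qed
  hence "monna x \<in> cball (trunc2 k x) (2 powi (- k))"
    by (rule Lim_in_closed_set[OF closed_cball _ sequentially_bot monna_LIMSEQ])
  thus ?thesis by (simp add: dist_Q2_def norm2_minus_commute[of "trunc2 k x"])
qed

lemma monna_vimage:
  obtains N :: nat where
    "monna -` cball a (2 powi (- k)) \<inter> {0..} = {real N / 2 powi k ..< (real N + 1) / 2 powi k}"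
proof -
  define a' where "a' = 2 powi (- k) * a"
  obtain j where "norm2 a' \<le> 2 ^ j"
    using real_arch_pow[of 2 "norm2 a'"] by (auto intro: less_imp_le)
  then obtain N where N: "norm2 (a' - bitrev N) \<le> 1" using bitrev_surj by blast
  have a: "a = 2 powi k * a'" by (simp add: a'_def power_int_minus)
  have "monna x \<in> cball a (2 powi (- k)) \<longleftrightarrow> x \<in> {real N / 2 powi k ..< (real N + 1) / 2 powi k}"
    if x: "x \<ge> 0" for x
  proof -
    let ?n = "nat \<lfloor>2 powi k * x\<rfloor>"
    have "monna x \<in> cball a (2 powi (- k)) \<longleftrightarrow> norm2 (a - monna x) \<le> 2 powi (- k)"
      by (simp add: dist_Q2_def)
    also have "\<dots> \<longleftrightarrow> norm2 (a - trunc2 k x) \<le> 2 powi (- k)"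
      using monna_trunc2[of x k] norm2_ultrametric_diff[of a "trunc2 k x" "monna x"]
        norm2_ultrametric_diff[of a "monna x" "trunc2 k x"]
      by (auto simp: norm2_minus_commute[of "trunc2 k x" "monna x"])
    also have "a - trunc2 k x = 2 powi k * (a' - bitrev ?n)"
      by (simp add: a trunc2_def algebra_simps)
    also have "norm2 (2 powi k * (a' - bitrev ?n)) \<le> 2 powi (- k) \<longleftrightarrow> norm2 (a' - bitrev ?n) \<le> 1"
      by (simp add: norm2_powi2_mult mult_le_cancel_left2 not_less[THEN iffD2, of 0])
    also have "\<dots> \<longleftrightarrow> ?n = N"
      using N bitrev_inj[of ?n N] norm2_ultrametric_diff[of "bitrev ?n" "bitrev N" a']
      by (auto simp: norm2_minus_commute[of "bitrev ?n" a'])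
    also have "\<dots> \<longleftrightarrow> \<lfloor>2 powi k * x\<rfloor> = int N"
      using x by auto
    also have "\<dots> \<longleftrightarrow> real N \<le> 2 powi k * x \<and> 2 powi k * x < real N + 1"
      by (simp add: floor_eq_iff)
    also have "\<dots> \<longleftrightarrow> x \<in> {real N / 2 powi k ..< (real N + 1) / 2 powi k}"
      by (simp add: field_simps)
    finally show ?thesis .
  qed
  moreover have "{real N / 2 powi k ..< (real N + 1) / 2 powi k} \<subseteq> {0..}"
    by (auto intro: order_trans[rotated])
  ultimately show ?thesis by (intro that[of N]) auto
qed

lemma haar_Q2_exists: "\<exists>M. haar_Q2 M"
proof
  let ?L = "restrict_space lborel {0::real..}"
  have sets_L: "A \<in> sets ?L \<longleftrightarrow> A \<subseteq> {0..} \<and> A \<in> sets borel" for A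
    by (simp add: sets_restrict_space_iff)
  have space_L: "space ?L = {0..}" by (simp add: space_restrict_space)
  have vim: "\<exists>N. monna -` cball a (2 powi k) \<inter> {0..} =
      {real N / 2 powi (- k) ..< (real N + 1) / 2 powi (- k)}" for a k
    using monna_vimage[of a "- k"] by (metis minus_minus)
  have "monna \<in> ?L \<rightarrow>\<^sub>M borel"
    unfolding borel_Q2_eq
  proof (rule measurable_measure_of)
    fix B assume "B \<in> balls2"
    thus "monna -` B \<inter> space ?L \<in> sets ?L"
    proof (cases rule: balls2E)
      case (2 q k)
      obtain N :: nat where "monna -` B \<inter> {0..} =
          {real N / 2 powi (- k) ..< (real N + 1) / 2 powi (- k)}"
        using vim[of "of_rat q" k] 2 by blast
      thus ?thesis unfolding space_L sets_L by (metis Int_lower2 atLeastLessThan_borel)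
    qed simp
  qed auto
  note meas = this
  have "emeasure (distr ?L borel monna) (cball a (2 powi k)) = ennreal (2 powi k)" for a k
  proof -
    obtain N :: nat where N: "monna -` cball a (2 powi k) \<inter> {0..} =
        {real N / 2 powi (- k) ..< (real N + 1) / 2 powi (- k)}"
      using vim[of a k] by blast
    have "emeasure (distr ?L borel monna) (cball a (2 powi k)) =
          emeasure ?L {real N / 2 powi (- k) ..< (real N + 1) / 2 powi (- k)}"
      unfolding N[symmetric] by (subst emeasure_distr[OF meas]) (auto simp: space_L)
    also have "\<dots> = emeasure lborel {real N / 2 powi (- k) ..< (real N + 1) / 2 powi (- k)}"
      unfolding N[symmetric] by (rule emeasure_restrict_space) auto
    also have "\<dots> = ennreal ((real N + 1) / 2 powi (- k) - real N / 2 powi (- k))"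
      by (intro emeasure_lborel_Ico divide_right_mono) auto
    also have "(real N + 1) / 2 powi (- k) - real N / 2 powi (- k) = 2 powi k"
      by (simp add: power_int_minus field_simps)
    finally show ?thesis .
  qed
  thus "haar_Q2 (distr ?L borel monna)" by (simp add: haar_Q2_iff)
qed

definition mu2 :: "Q2 measure"
  where "mu2 = (THE M. haar_Q2 M)"

lemma haar_Q2_mu2: "haar_Q2 mu2"
  unfolding mu2_def using haar_Q2_exists haar_Q2_unique by (metis theI)

lemma sets_mu2 [simp, measurable_cong]: "sets mu2 = sets borel"
  using haar_Q2_mu2 by (simp add: haar_Q2_def)

text \<open>
  The library metric on pairs is Euclidean rather than the maximum metric \<open>dist_K\<close>, but it
  induces the same topology (\<open>open_K_iff\<close>), and only the topology of \<open>K\<close> enters the boundary.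
\<close>

type_synonym K = "real \<times> Q2"

definition dist_K :: "K \<Rightarrow> K \<Rightarrow> real"
  where "dist_K x y = max \<bar>fst x - fst y\<bar> (norm2 (snd x - snd y))"

lemma open_K_iff: "open (S :: K set) \<longleftrightarrow> (\<forall>x\<in>S. \<exists>e>0. \<forall>y. dist_K x y < e \<longrightarrow> y \<in> S)"
proof -
  have dK: "dist_K x y = max (dist (fst x) (fst y)) (dist (snd x) (snd y))" for x y
    by (simp add: dist_K_def dist_Q2_def dist_real_def)
  have le: "dist_K x y \<le> dist x y" for x y
    by (simp add: dK dist_fst_le dist_snd_le)
  have ge: "dist x y \<le> 2 * dist_K x y" for x y :: K
    using sqrt_sum_squares_le_sum[of "dist (fst x) (fst y)" "dist (snd x) (snd y)"]
    by (simp add: dK dist_prod_def)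
  have "(\<exists>e>0. \<forall>y. dist_K x y < e \<longrightarrow> y \<in> S) \<longleftrightarrow> (\<exists>e>0. ball x e \<subseteq> S)" for x
  proof
    assume "\<exists>e>0. \<forall>y. dist_K x y < e \<longrightarrow> y \<in> S"
    thus "\<exists>e>0. ball x e \<subseteq> S" using le[of x] by (metis mem_ball order_le_less_trans subsetI)
  next
    assume "\<exists>e>0. ball x e \<subseteq> S"
    then obtain e where e: "e > 0" "ball x e \<subseteq> S" by blast
    have "y \<in> S" if "dist_K x y < e / 2" for y
    proof -
      have "y \<in> ball x e" using that ge[of x y] by simp
      thus ?thesis using e(2) by blast
    qed
    thus "\<exists>e>0. \<forall>y. dist_K x y < e \<longrightarrow> y \<in> S" using e(1) by (meson half_gt_zero)
  qed
  thus ?thesis unfolding open_contains_ball by simp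
qed

definition scaleQ :: "rat \<Rightarrow> K \<Rightarrow> K"
  where "scaleQ \<alpha> x = (of_rat \<alpha> * fst x, of_rat \<alpha> * snd x)"

definition phi :: "rat \<Rightarrow> K"
  where "phi z = (of_rat z, of_rat z)"

definition mu :: "K measure"
  where "mu = lborel \<Otimes>\<^sub>M mu2"

lemma sets_mu: "sets mu = sets borel"
  unfolding mu_def borel_prod[symmetric] by (rule sets_pair_measure_cong) simp_all

text \<open>
  \<open>d i\<close> is the digit with index \<open>- i\<close>, and the summation index is shifted so that it starts
  at 0. The series converges for every choice of digits (\<open>tile_series_summable\<close>).
\<close>

definition tile :: "K set"
  where "tile = {scaleQ (1/2) s | s.
    \<exists>d :: nat \<Rightarrow> rat. (\<forall>i\<ge>1. d i \<in> {0, 1, 2}) \<and>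
      (\<lambda>n. scaleQ ((- (3/2)) powi (- int (Suc n))) (phi (d (Suc n)))) sums s}"

lemma summable_Q2:
  fixes f :: "nat \<Rightarrow> Q2"
  assumes "(\<lambda>n. norm2 (f n)) \<longlonglongrightarrow> 0"
  shows "summable f"
proof -
  have "Cauchy (\<lambda>n. \<Sum>i<n. f i)"
    unfolding Cauchy_altdef2
  proof (intro allI impI)
    fix e :: real assume e: "e > 0"
    obtain N where N: "norm2 (f n) < e" if "n \<ge> N" for n
      using order_tendstoD(2)[OF assms e] by (auto simp: eventually_sequentially)
    have "dist (\<Sum>i<n. f i) (\<Sum>i<N. f i) < e" if "n \<ge> N" for n
      using that
    proof (induction n rule: dec_induct)
      case (step n)
      thus ?case
        using N[of n] norm2_ultrametric[of "(\<Sum>i<n. f i) - (\<Sum>i<N. f i)" "f n"]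
        by (simp add: dist_Q2_def algebra_simps)
    qed (use e in simp)
    thus "\<exists>N. \<forall>n\<ge>N. dist (\<Sum>i<n. f i) (\<Sum>i<N. f i) < e" by blast
  qed
  thus ?thesis by (simp add: summable_iff_convergent Cauchy_convergent)
qed

lemma tile_series_summable:
  assumes "\<And>i. i \<ge> 1 \<Longrightarrow> d i \<in> {0, 1, 2}"
  shows "summable (\<lambda>n. scaleQ ((- (3/2)) powi (- int (Suc n))) (phi (d (Suc n))))"
proof -
  let ?r = "\<lambda>n. (- (3/2)) powi (- int (Suc n)) * d (Suc n) :: rat"
  have r: "?r n = (- (2/3)) ^ Suc n * d (Suc n)" for n
    unfolding power_int_minus power_int_of_nat power_inverse[symmetric] by simp
  have "norm (of_rat (?r n) :: real) \<le> 2 * (2/3) ^ Suc n" for n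
  proof -
    have "\<bar>of_rat (d (Suc n)) :: real\<bar> \<le> 2"
      using assms[of "Suc n"] by auto
    moreover have "norm (of_rat (?r n) :: real) = (2/3) ^ Suc n * \<bar>of_rat (d (Suc n))\<bar>"
      unfolding r of_rat_mult of_rat_power real_norm_def abs_mult power_abs
      by (simp add: of_rat_minus of_rat_divide)
    ultimately show ?thesis by simp
  qed
  moreover have "summable (\<lambda>n. 2 * (2/3 :: real) ^ Suc n)"
    by (intro summable_mult) (simp add: summable_Suc_iff summable_geometric del: power_Suc)
  ultimately have 1: "summable (\<lambda>n. of_rat (?r n) :: real)"
    by (rule summable_comparison_test'[rotated])
  have "norm2 (of_rat (?r n)) \<le> (1/2) ^ Suc n" for n
  proof -
    have "abs2_rat (d (Suc n)) \<le> 1"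
      using assms[of "Suc n"] by (auto simp: abs2_rat_2)
    moreover have "abs2_rat (- (2/3)) = 1/2"
      using abs2_rat_quotient[of 2 3] by (simp add: not_dvd_imp_multiplicity_0 power_int_minus)
    hence "norm2 (of_rat (- (2/3))) = 1/2"
      by (simp only: norm_of_rat_Q2)
    hence "norm2 (of_rat (?r n)) = (1/2) ^ Suc n * abs2_rat (d (Suc n))"
      unfolding r of_rat_mult of_rat_power norm2_mult norm2_power by (simp only: norm_of_rat_Q2)
    ultimately show ?thesis by simp
  qed
  hence "(\<lambda>n. norm2 (of_rat (?r n))) \<longlonglongrightarrow> 0"
    by (intro tendsto_sandwich[OF _ _ tendsto_const LIMSEQ_Suc[OF LIMSEQ_power_zero[of "1/2 :: real"]]])
       (auto intro!: always_eventually)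
  hence 2: "summable (\<lambda>n. of_rat (?r n) :: Q2)" by (rule summable_Q2)
  obtain a b where ab: "(\<lambda>n. of_rat (?r n) :: real) sums a" "(\<lambda>n. of_rat (?r n) :: Q2) sums b"
    using 1 2 unfolding summable_def by blast
  have eq: "(\<lambda>n. scaleQ ((- (3/2)) powi (- int (Suc n))) (phi (d (Suc n)))) =
        (\<lambda>n. (of_rat (?r n), of_rat (?r n)))"
    by (simp only: scaleQ_def phi_def of_rat_mult fst_conv snd_conv)
  have "(\<lambda>n. (of_rat (?r n), of_rat (?r n)) :: K) sums (a, b)"
    using ab unfolding sums_def by (simp only: sum_prod tendsto_Pair)
  thus ?thesis unfolding eq summable_def by blast
qed

end

theory Submission
  imports Defs
begin

text \<open>
  Multiplication by \<open>-2/3\<close> scales \<open>\<mu>\<close> by \<open>2/3 * 1/2 = 1/3\<close>, and the tile is the union of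
  its \<open>3 ^ n\<close> images under the words of length \<open>n\<close> in the maps \<open>x \<mapsto> -2/3 (x + \<phi>(d/2))\<close>.
  The measures of these pieces add up to the (finite) measure of the tile, so distinct pieces
  overlap in null sets. Since \<open>\<int>[1/2]\<close> is cocompact in \<open>K\<close> and \<open>{0, 1/2, 1}\<close> represents
  \<open>\<int>[1/2] / 3 \<int>[1/2]\<close>, finitely many integer translates of the tile cover \<open>[0,1] \<times> \<int>\<^sub>2\<close>;
  hence the tile has an interior point. For large \<open>n\<close> some piece lies in the interior of the tile.
  Each boundary point of that piece also belongs to another piece, so the boundary of the piece is
  a null set, and by scaling so is the boundary of the tile.
\<close>

subsection \<open>Affine maps of \<open>K\<close> with rational coefficients\<close>

text \<open>Multiplication by \<open>c\<close> scales every distance by exactly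
  \<open>norm2 c\<close>.\<close>

lemma tendsto_mult_left_Q2:
  fixes c :: Q2
  assumes "(X \<longlongrightarrow> x) F"
  shows "((\<lambda>n. c * X n) \<longlongrightarrow> c * x) F"
proof -
  have "((\<lambda>n. norm2 c * dist (X n) x) \<longlongrightarrow> 0) F"
    using assms by (intro tendsto_mult_right_zero) (simp only: tendsto_dist_iff[of _ x])
  moreover have "norm2 c * dist (X n) x = dist (c * X n) (c * x)" for n
    by (simp add: dist_Q2_def norm2_mult flip: right_diff_distrib)
  ultimately show ?thesis
    by (simp only: tendsto_dist_iff[of _ "c * x"])
qed

lemma phi_0: "phi 0 = 0"
  by (simp add: phi_def zero_prod_def)

lemma phi_add: "phi (a + b) = phi a + phi b"
  by (simp add: phi_def of_rat_add)

lemma scaleQ_1: "scaleQ 1 x = x"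
  by (simp add: scaleQ_def)

lemma scaleQ_0: "scaleQ c 0 = 0"
  by (simp add: scaleQ_def zero_prod_def)

lemma sum_phi: "(\<Sum>i\<in>A. phi (f i)) = phi (sum f A)"
  by (induction A rule: infinite_finite_induct) (simp_all add: phi_0 phi_add)

lemma scaleQ_add: "scaleQ c (x + y) = scaleQ c x + scaleQ c y"
  by (simp add: scaleQ_def distrib_left)

lemma scaleQ_scaleQ: "scaleQ a (scaleQ b x) = scaleQ (a * b) x"
  by (simp add: scaleQ_def of_rat_mult mult.assoc)

lemma scaleQ_phi: "scaleQ c (phi r) = phi (c * r)"
  by (simp add: scaleQ_def phi_def of_rat_mult)

text \<open>This family is closed under composition and, for \<open>c \<noteq> 0\<close>, under
  inverses, so topology and measure are treated once for all words and all translations.\<close>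

definition affine_K :: "rat \<Rightarrow> rat \<Rightarrow> K \<Rightarrow> K"
  where "affine_K c r x = phi r + scaleQ c x"

lemma affine_K_Pair: "affine_K c r x = (of_rat r + of_rat c * fst x, of_rat r + of_rat c * snd x)"
  by (simp add: affine_K_def phi_def scaleQ_def)

lemma affine_K_phi: "affine_K c r (phi s) = phi (r + c * s)"
  by (simp add: affine_K_def scaleQ_phi phi_add)

lemma affine_K_0: "affine_K c 0 x = scaleQ c x"
  by (simp add: affine_K_def phi_0)

lemma affine_K_affine_K: "affine_K c r (affine_K c' r' x) = affine_K (c * c') (r + c * r') x"
  by (simp add: affine_K_def scaleQ_add scaleQ_scaleQ scaleQ_phi phi_add add.assoc)

lemma affine_K_id [simp]: "affine_K 1 0 x = x"
  by (simp add: affine_K_Pair)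

lemma affine_K_eq_iff: "c \<noteq> 0 \<Longrightarrow> y = affine_K c r x \<longleftrightarrow> x = affine_K (1/c) (-r/c) y"
  by (auto simp: affine_K_affine_K)

lemma inj_affine_K: "c \<noteq> 0 \<Longrightarrow> inj (affine_K c r)"
  by (metis affine_K_eq_iff injI)

lemma tendsto_affine_K:
  assumes "(X \<longlongrightarrow> x) F"
  shows "((\<lambda>n. affine_K c r (X n)) \<longlongrightarrow> affine_K c r x) F"
  unfolding affine_K_Pair
  by (intro tendsto_Pair tendsto_add tendsto_const tendsto_mult_left tendsto_mult_left_Q2
      tendsto_fst tendsto_snd assms)

lemma continuous_on_affine_K: "continuous_on A (affine_K c r)"
  unfolding continuous_on_def by (intro ballI tendsto_affine_K tendsto_ident_at)

lemma closed_vimage_affine_K: "closed A \<Longrightarrow> closed (affine_K c r -` A)"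
  by (intro closed_vimage continuous_on_affine_K)

lemma open_vimage_affine_K: "open A \<Longrightarrow> open (affine_K c r -` A)"
  by (intro open_vimage continuous_on_affine_K)

text \<open>An image is the preimage under the inverse map, so images inherit closedness and
  openness from continuity.\<close>

lemma image_affine_K: "c \<noteq> 0 \<Longrightarrow> affine_K c r ` A = affine_K (1/c) (-r/c) -` A"
  unfolding image_def vimage_def by (simp add: affine_K_eq_iff[of c _ r])

lemma closed_image_affine_K: "c \<noteq> 0 \<Longrightarrow> closed A \<Longrightarrow> closed (affine_K c r ` A)"
  by (simp add: image_affine_K closed_vimage_affine_K)

text \<open>Each coordinate is scaled by its own absolute value of \<open>c\<close>; under the
  maximum metric a common bound \<open>q\<close> is a Lipschitz constant.\<close>

lemma dist_K_affine_K_le: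
  assumes "\<bar>c\<bar> \<le> q" "abs2_rat c \<le> of_rat q"
  shows "dist_K (affine_K c r x) (affine_K c r y) \<le> of_rat q * dist_K x y"
proof -
  have "\<bar>of_rat c :: real\<bar> \<le> of_rat q"
    using assms(1) by (metis abs_le_iff of_rat_less_eq of_rat_minus)
  moreover have q: "0 \<le> (of_rat q :: real)"
    using assms(2) abs2_rat_nonneg order_trans by blast
  ultimately have "\<bar>of_rat c\<bar> * \<bar>fst x - fst y\<bar> \<le> of_rat q * dist_K x y"
    unfolding dist_K_def by (intro mult_mono) auto
  moreover have "abs2_rat c * norm2 (snd x - snd y) \<le> of_rat q * dist_K x y"
    unfolding dist_K_def using assms(2) q by (intro mult_mono) auto
  ultimately show ?thesis
    by (simp add: affine_K_Pair dist_K_def[of "(_, _)"] norm2_mult abs_mult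
        flip: right_diff_distrib)
qed

lemma abs2_rat_two_thirds: "abs2_rat (2/3) = 1/2"
  using abs2_rat_quotient[of 2 3] by (simp add: not_dvd_imp_multiplicity_0 power_int_minus)

lemma abs2_rat_power: "abs2_rat (c ^ n) = abs2_rat c ^ n"
  by (induction n) (simp_all add: abs2_rat_mult)

subsection \<open>The tile as an attractor\<close>

definition digits :: "rat set"
  where "digits = {0, 1, 2}"

text \<open>Horner form of half a partial digit series. The head of the list is the leading
  digit.\<close>

fun offset :: "rat list \<Rightarrow> rat"
  where "offset [] = 0"
  | "offset (d # w) = - (2/3) * (d / 2 + offset w)"

text \<open>Closed form of the composition of the maps
  \<open>x \<mapsto> -2/3 (x + phi (d/2))\<close> along the word, with the head outermost.\<close>

definition piece_map :: "rat list \<Rightarrow> K \<Rightarrow> K"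
  where "piece_map w = affine_K ((- (2/3)) ^ length w) (offset w)"

lemma piece_map_Nil [simp]: "piece_map [] x = x"
  by (simp add: piece_map_def)

lemma piece_map_Cons: "piece_map (d # w) x = piece_map [d] (piece_map w x)"
  by (simp add: piece_map_def affine_K_affine_K algebra_simps)

lemma piece_map_single: "piece_map [d] x = scaleQ (- (2/3)) (phi (d/2) + x)"
  by (simp add: piece_map_def affine_K_def scaleQ_add scaleQ_phi)

lemma piece_map_0: "piece_map w 0 = phi (offset w)"
  unfolding phi_0[symmetric] piece_map_def affine_K_phi by simp

text \<open>The factor \<open>-2/3\<close> has real absolute value 2/3 and 2-adic absolute value
  1/2; the larger one governs.\<close>

lemma dist_K_affine_K_power:
  "dist_K (affine_K ((- (2/3)) ^ n) r x) (affine_K ((- (2/3)) ^ n) r y) \<le> (2/3) ^ n * dist_K x y"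
proof -
  have "dist_K (affine_K ((- (2/3)) ^ n) r x) (affine_K ((- (2/3)) ^ n) r y)
      \<le> of_rat ((2/3) ^ n) * dist_K x y"
    by (rule dist_K_affine_K_le)
       (simp_all add: power_abs abs2_rat_power abs2_rat_two_thirds of_rat_power of_rat_divide
          power_mono del: power_divide)
  thus ?thesis by (simp add: of_rat_power of_rat_divide)
qed

lemma dist_K_piece_map: "dist_K (piece_map w x) (piece_map w y) \<le> (2/3) ^ length w * dist_K x y"
  unfolding piece_map_def by (rule dist_K_affine_K_power)

lemma offset_map: "offset (map e [0..<n]) = (\<Sum>i<n. (- (2/3)) ^ Suc i * e i) / 2"
proof (induction n arbitrary: e)
  case (Suc n)
  have "offset (map e [0..<Suc n]) = - (2/3) * (e 0 / 2 + offset (map (\<lambda>i. e (Suc i)) [0..<n]))"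
    by (simp only: map_upt_Suc offset.simps)
  moreover define S where "S = (\<Sum>i<n. (- (2/3)) ^ Suc i * e (Suc i))"
  have "(\<Sum>i<Suc n. (- (2/3)) ^ Suc i * e i) = - (2/3) * e 0 + - (2/3) * S"
    unfolding S_def sum.lessThan_Suc_shift sum_distrib_left power_Suc[of _ "Suc _"]
    by (simp only: mult.assoc power_Suc power_0 mult_1_right)
  ultimately show ?case
    unfolding Suc S_def[symmetric] by (simp only:) (simp add: field_simps)
qed simp

lemma sum_series_eq_phi:
  "(\<Sum>i<n. scaleQ ((- (3/2)) powi (- int (Suc i))) (phi (d (Suc i)))) =
   phi (2 * offset (map (\<lambda>i. d (Suc i)) [0..<n]))"
proof -
  have "(- (3/2) :: rat) powi (- int (Suc i)) = (- (2/3)) ^ Suc i" for i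
    unfolding power_int_minus power_int_of_nat power_inverse[symmetric] by simp
  moreover have "2 * offset (map (\<lambda>i. d (Suc i)) [0..<n]) = (\<Sum>i<n. (- (2/3)) ^ Suc i * d (Suc i))"
    by (simp add: offset_map)
  ultimately show ?thesis
    by (simp only: scaleQ_phi sum_phi)
qed

text \<open>The partial sums, halved, are the images of 0 under the prefix words, so tile points
  become limits of \<open>offset\<close> along prefixes.\<close>

lemma tile_iff:
  "x \<in> tile \<longleftrightarrow> (\<exists>e. (\<forall>i. e i \<in> digits) \<and> (\<lambda>n. phi (offset (map e [0..<n]))) \<longlonglongrightarrow> x)"
proof
  assume "x \<in> tile"
  then obtain s and d :: "nat \<Rightarrow> rat" where x: "x = scaleQ (1/2) s"
    and d: "\<forall>i\<ge>1. d i \<in> {0, 1, 2}"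
    and "(\<lambda>n. scaleQ ((- (3/2)) powi (- int (Suc n))) (phi (d (Suc n)))) sums s"
    unfolding tile_def by blast
  hence "(\<lambda>n. phi (2 * offset (map (\<lambda>i. d (Suc i)) [0..<n]))) \<longlonglongrightarrow> s"
    by (simp only: sums_def sum_series_eq_phi)
  from tendsto_affine_K[OF this, of "1/2" 0]
  have "(\<lambda>n. phi (offset (map (\<lambda>i. d (Suc i)) [0..<n]))) \<longlonglongrightarrow> x"
    unfolding affine_K_phi affine_K_0 x by simp
  thus "\<exists>e. (\<forall>i. e i \<in> digits) \<and> (\<lambda>n. phi (offset (map e [0..<n]))) \<longlonglongrightarrow> x"
    using d by (intro exI[of _ "\<lambda>i. d (Suc i)"] conjI) (simp_all add: digits_def)
next
  assume "\<exists>e. (\<forall>i. e i \<in> digits) \<and> (\<lambda>n. phi (offset (map e [0..<n]))) \<longlonglongrightarrow> x"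
  then obtain e where e: "\<forall>i. e i \<in> digits" and lim: "(\<lambda>n. phi (offset (map e [0..<n]))) \<longlonglongrightarrow> x"
    by (elim exE conjE)
  \<comment> \<open>The series reads its digits from index 1, whereas \<open>e\<close> starts at
    0.\<close>
  define d where "d i = e (i - 1)" for i
  have "(\<lambda>n. phi (2 * offset (map (\<lambda>i. d (Suc i)) [0..<n]))) \<longlonglongrightarrow> scaleQ 2 x"
    using tendsto_affine_K[OF lim, of 2 0] unfolding affine_K_phi affine_K_0 by (simp add: d_def)
  hence "(\<lambda>n. scaleQ ((- (3/2)) powi (- int (Suc n))) (phi (d (Suc n)))) sums scaleQ 2 x"
    by (simp only: sums_def sum_series_eq_phi)
  moreover have "x = scaleQ (1/2) (scaleQ 2 x)"
    by (simp add: scaleQ_scaleQ) (simp add: scaleQ_def)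
  moreover have "\<forall>i\<ge>1. d i \<in> {0, 1, 2}" using e by (simp add: d_def digits_def)
  ultimately show "x \<in> tile" unfolding tile_def by blast
qed

lemma tileE:
  assumes "x \<in> tile"
  obtains e where "\<forall>i. e i \<in> digits" "(\<lambda>n. phi (offset (map e [0..<n]))) \<longlonglongrightarrow> x"
  using assms unfolding tile_iff by (elim exE conjE) (rule that)

section \<open>Bounding box, self-similarity and closedness of the tile\<close>

definition tile_box :: "K set"
  where "tile_box = {-2..2} \<times> cball 0 1"

lemma closed_box: "closed tile_box"
  unfolding tile_box_def by (intro closed_Times) auto

text \<open>The box is chosen to be invariant: on the real side \<open>2/3 * (1 + 2) = 2\<close>,
  and on the 2-adic side \<open>d/2\<close> has norm at most 2, which the factor 1/2 brings back to
  1.\<close>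

lemma piece_map_in_box:
  assumes "d \<in> digits" "x \<in> tile_box"
  shows "piece_map [d] x \<in> tile_box"
proof -
  have eq: "piece_map [d] x =
      (of_rat (- (2/3)) * (of_rat (d/2) + fst x), of_rat (- (2/3)) * (of_rat (d/2) + snd x))"
    by (simp only: piece_map_single scaleQ_def phi_def fst_add snd_add fst_conv snd_conv)
  have "norm2 (of_rat (d/2)) \<le> 2"
    using assms(1) abs2_rat_inverse[of 2] by (auto simp: digits_def abs2_rat_2 inverse_eq_divide)
  moreover have "norm2 (snd x) \<le> 1" using assms(2) by (auto simp: tile_box_def dist_Q2_def)
  ultimately have "norm2 (of_rat (d/2) + snd x) \<le> 2"
    using norm2_ultrametric[of "of_rat (d/2)" "snd x"] by linarith
  hence "norm2 (snd (piece_map [d] x)) \<le> 1"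
    unfolding eq snd_conv norm2_mult norm_of_rat_Q2 abs2_rat_minus abs2_rat_two_thirds by simp
  moreover have "fst (piece_map [d] x) \<in> {-2..2}"
    unfolding eq using assms
    by (auto simp: digits_def tile_box_def of_rat_minus of_rat_divide) (simp_all add: field_simps)
  ultimately show ?thesis
    by (cases "piece_map [d] x") (simp add: tile_box_def dist_Q2_def)
qed

lemma phi_offset_in_box: "set w \<subseteq> digits \<Longrightarrow> phi (offset w) \<in> tile_box"
proof (induction w)
  case Nil
  thus ?case by (simp add: phi_0 tile_box_def zero_prod_def)
next
  case (Cons d w)
  have "phi (offset (d # w)) = piece_map [d] (phi (offset w))"
    unfolding piece_map_0[symmetric] by (rule piece_map_Cons)
  thus ?case using Cons by (simp add: piece_map_in_box del: offset.simps)
qed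

lemma tile_subset_box: "tile \<subseteq> tile_box"
proof
  fix x assume "x \<in> tile"
  then obtain e where "\<forall>i. e i \<in> digits" "(\<lambda>n. phi (offset (map e [0..<n]))) \<longlonglongrightarrow> x"
    by (rule tileE)
  moreover from this have "phi (offset (map e [0..<n])) \<in> tile_box" for n
    by (intro phi_offset_in_box) auto
  ultimately show "x \<in> tile_box"
    using closed_sequentially[OF closed_box, of "\<lambda>n. phi (offset (map e [0..<n]))" x] by simp
qed

text \<open>Removing the first digit leaves a digit sequence whose limit is again in the
  tile.\<close>

lemma tile_unfold:
  assumes "x \<in> tile"
  obtains d y where "d \<in> digits" "y \<in> tile" "x = piece_map [d] y"
proof -
  obtain e where e: "\<forall>i. e i \<in> digits" and lim: "(\<lambda>n. phi (offset (map e [0..<n]))) \<longlonglongrightarrow> x"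
    using assms by (rule tileE)
  \<comment> \<open>The coefficients are those of the inverse of
    \<open>piece_map [e 0]\<close>.\<close>
  let ?y = "affine_K (- (3/2)) (- e 0 / 2) x"
  have "(\<lambda>n. affine_K (- (3/2)) (- e 0 / 2) (phi (offset (map e [0..<Suc n])))) \<longlonglongrightarrow> ?y"
    by (rule tendsto_affine_K, rule LIMSEQ_Suc[OF lim])
  hence "(\<lambda>n. phi (offset (map (\<lambda>i. e (Suc i)) [0..<n]))) \<longlonglongrightarrow> ?y"
    unfolding map_upt_Suc affine_K_phi offset.simps by (simp add: algebra_simps)
  hence "?y \<in> tile" unfolding tile_iff by (intro exI[of _ "\<lambda>i. e (Suc i)"] conjI allI e[rule_format])
  moreover have "x = piece_map [e 0] ?y"
    by (simp add: piece_map_def affine_K_affine_K)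
  ultimately show ?thesis using that e by blast
qed

lemma box_dist_K_le: "x \<in> tile_box \<Longrightarrow> y \<in> tile_box \<Longrightarrow> dist_K x y \<le> 4"
  using norm2_ultrametric[of "snd x" "- snd y"]
  by (cases x; cases y) (auto simp: tile_box_def dist_K_def dist_Q2_def)

lemma dist_K_LIMSEQ:
  assumes "(\<lambda>n. dist_K (X n) x) \<longlonglongrightarrow> 0"
  shows "X \<longlonglongrightarrow> x"
proof (rule topological_tendstoI)
  fix S assume "open S" "x \<in> S"
  then obtain r where r: "r > 0" "\<And>y. dist_K x y < r \<Longrightarrow> y \<in> S"
    unfolding open_K_iff by blast
  show "eventually (\<lambda>n. X n \<in> S) sequentially"
    using order_tendstoD(2)[OF assms r(1)]
    by eventually_elim
       (use r(2) in \<open>simp add: dist_K_def norm2_minus_commute abs_minus_commute\<close>)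
qed

text \<open>
  A coinduction principle, which yields closedness of the tile without a compactness argument
  on digit sequences.
\<close>

lemma subset_tileI:
  assumes "A \<subseteq> tile_box" and A: "\<And>x. x \<in> A \<Longrightarrow> \<exists>d\<in>digits. \<exists>y\<in>A. x = piece_map [d] y"
  shows "A \<subseteq> tile"
proof
  fix x assume x: "x \<in> A"
  \<comment> \<open>Unfolding \<open>x\<close> forever inside \<open>A\<close> yields its digits
    together with the remainders \<open>f n\<close>.\<close>
  have "\<exists>f :: nat \<Rightarrow> K. \<forall>n. (f n \<in> A \<and> (n = 0 \<longrightarrow> f n = x)) \<and>
      (\<exists>d\<in>digits. f n = piece_map [d] (f (Suc n)))"
    by (rule dependent_nat_choice) (use x A in blast)+
  then obtain f :: "nat \<Rightarrow> K" where f: "\<And>n. f n \<in> A" "f 0 = x"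
    "\<And>n. \<exists>d\<in>digits. f n = piece_map [d] (f (Suc n))" by blast
  then obtain e where e: "\<And>n. e n \<in> digits" "\<And>n. f n = piece_map [e n] (f (Suc n))" by metis
  have iter: "g 0 = piece_map (map e' [0..<n]) (g n)"
    if "\<And>n. g n = piece_map [e' n] (g (Suc n))" for g :: "nat \<Rightarrow> K" and e' n
    using that
  proof (induction n arbitrary: g e')
    case (Suc n)
    have "g (Suc 0) = piece_map (map (\<lambda>i. e' (Suc i)) [0..<n]) (g (Suc n))"
      by (rule Suc.IH) (rule Suc.prems)
    thus ?case unfolding map_upt_Suc using Suc.prems[of 0] by (subst piece_map_Cons) simp
  next
    case 0
    show ?case by simp
  qed
  \<comment> \<open>The prefix word sends 0 to the partial value and the remainder
    \<open>f n\<close> to \<open>x\<close>; both arguments lie in the box, of diameter at most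
    4.\<close>
  have "dist_K (phi (offset (map e [0..<n]))) x \<le> (2/3) ^ n * 4" for n
  proof -
    have "x = piece_map (map e [0..<n]) (f n)"
      using iter[of f e n, OF e(2)] unfolding f(2) .
    hence "dist_K (phi (offset (map e [0..<n]))) x \<le> (2/3) ^ n * dist_K 0 (f n)"
      using dist_K_piece_map[of "map e [0..<n]" 0 "f n"] by (simp add: piece_map_0)
    also have "\<dots> \<le> (2/3) ^ n * 4"
      using f(1)[of n] assms(1) by (intro mult_left_mono box_dist_K_le) (auto simp: tile_box_def zero_prod_def)
    finally show ?thesis .
  qed
  hence "(\<lambda>n. dist_K (phi (offset (map e [0..<n]))) x) \<longlonglongrightarrow> 0"
    by (intro tendsto_sandwich[OF _ _ tendsto_const
          tendsto_mult_left_zero[OF LIMSEQ_power_zero[of "2/3 :: real"], of 4]])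
       (auto intro!: always_eventually simp: dist_K_def max_def)
  thus "x \<in> tile"
    unfolding tile_iff by (intro exI[of _ e] conjI allI e(1) dist_K_LIMSEQ)
qed

text \<open>Coinduction on the tile enlarged by the new point, which unfolds to \<open>x\<close> by
  the digit \<open>d\<close>.\<close>

lemma piece_map_in_tile:
  assumes "d \<in> digits" "x \<in> tile"
  shows "piece_map [d] x \<in> tile"
proof -
  have "insert (piece_map [d] x) tile \<subseteq> tile"
  proof (rule subset_tileI)
    show "insert (piece_map [d] x) tile \<subseteq> tile_box"
      using tile_subset_box piece_map_in_box assms by blast
    fix y assume "y \<in> insert (piece_map [d] x) tile"
    then consider "y = piece_map [d] x" | "y \<in> tile" by blast
    thus "\<exists>d'\<in>digits. \<exists>z\<in>insert (piece_map [d] x) tile. y = piece_map [d'] z"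
    proof cases
      case 2
      then obtain d' z where "d' \<in> digits" "z \<in> tile" "y = piece_map [d'] z" by (rule tile_unfold)
      thus ?thesis by blast
    qed (use assms in blast)
  qed
  thus ?thesis by blast
qed

text \<open>The origin is the fixed point of the map with digit 0.\<close>

lemma zero_in_tile: "0 \<in> tile"
proof -
  have "{0} \<subseteq> tile"
    by (rule subset_tileI) (auto simp: tile_box_def zero_prod_def piece_map_def affine_K_Pair digits_def)
  thus ?thesis by simp
qed

text \<open>The three images of the closure form a closed set containing the tile, hence its
  closure. So the closure unfolds into itself, and coinduction puts it inside the tile.\<close>

lemma closed_tile: "closed tile"
proof -
  have "closure tile \<subseteq> (\<Union>d\<in>digits. piece_map [d] ` closure tile)"
  proof (rule closure_minimal)
    show "tile \<subseteq> (\<Union>d\<in>digits. piece_map [d] ` closure tile)"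
    proof
      fix x assume "x \<in> tile"
      then obtain d y where "d \<in> digits" "y \<in> tile" "x = piece_map [d] y" by (rule tile_unfold)
      thus "x \<in> (\<Union>d\<in>digits. piece_map [d] ` closure tile)"
        using closure_subset[of tile] by blast
    qed
    show "closed (\<Union>d\<in>digits. piece_map [d] ` closure tile)"
      unfolding piece_map_def by (intro closed_UN ballI closed_image_affine_K) (auto simp: digits_def)
  qed
  hence "closure tile \<subseteq> tile"
    using closure_minimal[OF tile_subset_box closed_box] by (intro subset_tileI) blast+
  thus ?thesis by (metis closure_subset closure_closed subset_antisym closed_closure)
qed

subsection \<open>Expansions of dyadic rationals and interior points\<close>

text \<open>The ring \<open>\<int>[1/2]\<close> inside the rationals.\<close>

definition dyadic :: "rat set"
  where "dyadic = {of_int a / 2 ^ k | a k. True}"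

lemma dyadicI: "of_int a / 2 ^ k \<in> dyadic"
  by (auto simp: dyadic_def)

lemma dyadicE:
  assumes "m \<in> dyadic"
  obtains a :: int and k where "m = of_int a / 2 ^ k"
  using assms by (auto simp: dyadic_def)

lemma dyadic_add_int:
  assumes "m \<in> dyadic"
  shows "m + of_int c \<in> dyadic"
proof -
  obtain a :: int and k where m: "m = of_int a / 2 ^ k" using assms by (rule dyadicE)
  have "m + of_int c = of_int (a + c * 2 ^ k) / 2 ^ k"
    by (simp add: m add_divide_distrib)
  thus ?thesis by (simp only: dyadicI)
qed

lemma dyadic_half:
  assumes "m \<in> dyadic"
  shows "m / 2 \<in> dyadic"
proof -
  obtain a :: int and k where m: "m = of_int a / 2 ^ k" using assms by (rule dyadicE)
  have "m / 2 = of_int a / 2 ^ Suc k" by (simp add: m)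
  thus ?thesis by (simp only: dyadicI)
qed

text \<open>An odd numerator over a positive power of 2 has 2-adic absolute value above 1, so
  factors of 2 cancel until the denominator is gone.\<close>

lemma dyadic_imp_int:
  assumes "m \<in> dyadic" "abs2_rat m \<le> 1"
  obtains i where "m = of_int i"
proof -
  obtain a :: int and k where m: "m = of_int a / 2 ^ k" using assms(1) by (rule dyadicE)
  have "\<exists>i. (of_int a / 2 ^ k :: rat) = of_int i" if "abs2_rat (of_int a / 2 ^ k) \<le> 1" for a
    using that
  proof (induction k arbitrary: a)
    case 0
    show ?case by simp
  next
    case (Suc k)
    have "even a"
    proof (rule ccontr)
      assume a: "odd a"
      hence "a \<noteq> 0" by auto
      hence "abs2_rat (of_int a / of_int (2 ^ Suc k)) = 2 ^ Suc k"
        using a multiplicity_same_power[of "2::int" "Suc k"]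
        by (subst abs2_rat_quotient)
           (simp_all add: not_dvd_imp_multiplicity_0 del: power_Suc of_nat_Suc)
      moreover have "(2::real) ^ Suc k > 1" by (rule one_less_power) auto
      ultimately show False using Suc.prems by simp
    qed
    then obtain b where b: "a = 2 * b" by blast
    have "(of_int a / 2 ^ Suc k :: rat) = of_int b / 2 ^ k" by (simp add: b)
    thus ?case using Suc by simp
  qed
  thus ?thesis using assms(2) that unfolding m by blast
qed

text \<open>The digits represent the classes of \<open>\<int>[1/2]\<close> modulo \<open>3 \<int>[1/2]\<close>, because \<open>4 ^ k\<close> is 1 modulo 3.\<close>

lemma dyadic_digit:
  assumes "m \<in> dyadic"
  obtains l d where "l \<in> dyadic" "d \<in> digits" "m = d / 2 - 3 / 2 * l"
proof -
  obtain a :: int and k where m: "m = of_int a / 2 ^ k" using assms by (rule dyadicE)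
  \<comment> \<open>The equation forces \<open>d\<close> to be congruent to \<open>2 * m\<close>
    modulo 3; since \<open>2 ^ k\<close> is its own inverse modulo 3, dividing by it amounts to
    multiplying by it.\<close>
  define d where "d = (2 ^ k * (2 * a)) mod 3"
  have "2 ^ k * d mod 3 = (2 ^ k * 2 ^ k) * (2 * a) mod 3"
    by (simp only: d_def mod_mult_right_eq mult.assoc)
  also have "(2 ^ k * 2 ^ k :: int) = 4 ^ k"
    by (simp flip: power_mult_distrib)
  also have "4 ^ k * (2 * a) mod 3 = (4 mod 3) ^ k * (2 * a) mod 3"
    by (metis mod_mult_left_eq power_mod)
  finally have "3 dvd 2 ^ k * d - 2 * a"
    by (simp add: mod_eq_dvd_iff)
  then obtain b where b: "2 ^ k * d - 2 * a = 3 * b" by blast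
  hence "(2 ^ k * of_int d - 2 * of_int a :: rat) = 3 * of_int b"
    by (metis of_int_diff of_int_mult of_int_numeral of_int_power)
  hence "m = of_int d / 2 - 3 / 2 * (of_int b / 2 ^ k)"
    by (simp add: m field_simps)
  moreover have "0 \<le> d" "d < 3" by (auto simp: d_def)
  hence "d = 0 \<or> d = 1 \<or> d = 2" by linarith
  hence "of_int d \<in> digits" by (auto simp: digits_def)
  ultimately show ?thesis using that dyadicI by blast
qed

text \<open>Repeated division with remainder by \<open>-3/2\<close>: the quotient replaces
  \<open>l\<close>, and the digit is prepended to \<open>t\<close>, which stays in the tile.\<close>

lemma dyadic_expansion:
  assumes "m \<in> dyadic"
  shows "\<exists>l\<in>dyadic. \<exists>t\<in>tile. phi m = scaleQ ((- (3/2)) ^ n) (phi l + t)"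
proof (induction n)
  case 0
  show ?case using assms zero_in_tile by (auto simp: scaleQ_def phi_def intro!: bexI[of _ 0] bexI[of _ m])
next
  case (Suc n)
  then obtain l t where lt: "l \<in> dyadic" "t \<in> tile" "phi m = scaleQ ((- (3/2)) ^ n) (phi l + t)"
    by blast
  obtain l' d where l': "l' \<in> dyadic" "d \<in> digits" "l = d / 2 - 3 / 2 * l'"
    using lt(1) by (rule dyadic_digit)
  have "phi l = phi (d / 2) + scaleQ (- (3/2)) (phi l')"
    by (simp add: l'(3) scaleQ_phi flip: phi_add)
  moreover have "scaleQ (- (3/2)) (piece_map [d] t) = phi (d / 2) + t"
    by (simp add: piece_map_single scaleQ_scaleQ scaleQ_1)
  ultimately have "phi l + t = scaleQ (- (3/2)) (phi l' + piece_map [d] t)"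
    by (simp add: scaleQ_add add_ac)
  hence "phi m = scaleQ ((- (3/2)) ^ Suc n) (phi l' + piece_map [d] t)"
    by (simp add: lt(3) scaleQ_scaleQ mult.commute)
  thus ?case using l' piece_map_in_tile lt(2) by blast
qed

section \<open>Cocompactness of the dyadic rationals in \<open>K\<close>\<close>

lemma bitrev_dyadic: "\<exists>r\<in>dyadic. bitrev n = of_rat r"
proof (induction n rule: less_induct)
  case (less n)
  show ?case
  proof (cases "n = 0")
    case True
    thus ?thesis using dyadicI[of 0 0] by (intro bexI[of _ 0]) auto
  next
    case False
    then obtain r where r: "r \<in> dyadic" "bitrev (n div 2) = of_rat r"
      using less[of "n div 2"] by auto
    have "bitrev n = of_rat ((r + of_int (int (n mod 2))) / 2)"
      by (subst bitrev_rec) (simp add: r(2) of_rat_divide of_rat_add del: of_nat_mod)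
    thus ?thesis using dyadic_half[OF dyadic_add_int[OF r(1)]] by blast
  qed
qed

lemma norm2_of_int: "norm2 (of_int i) \<le> 1"
proof (cases "i = 0")
  case False
  have "norm2 (of_rat (of_int i)) \<le> 1"
    unfolding norm_of_rat_Q2 abs2_rat_of_int[OF False] by (simp add: power_int_minus inverse_le_1_iff)
  thus ?thesis by simp
qed simp

definition unit_box :: "K set"
  where "unit_box = {0..1} \<times> cball 0 1"

text \<open>A bit-reversed number first corrects the 2-adic coordinate. An integer then corrects the
  real one without spoiling the 2-adic bound, integers having norm at most 1.\<close>

lemma dyadic_approx:
  obtains m where "m \<in> dyadic" "x - phi m \<in> unit_box"
proof -
  obtain j where "norm2 (snd x) \<le> 2 ^ j"
    using real_arch_pow[of 2 "norm2 (snd x)"] by (auto intro: less_imp_le)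
  then obtain r where r: "r \<in> dyadic" "norm2 (snd x - of_rat r) \<le> 1"
    using bitrev_surj bitrev_dyadic by metis
  define i where "i = \<lfloor>fst x - of_rat r\<rfloor>"
  have "norm2 (snd x - of_rat (r + of_int i)) \<le> 1"
    using norm2_ultrametric[of "snd x - of_rat r" "- of_int i"] r(2) norm2_of_int[of i]
    by (simp add: of_rat_add diff_diff_eq)
  moreover have "fst x - of_rat (r + of_int i) \<in> {0..1}"
    unfolding i_def of_rat_add of_rat_of_int_eq atLeastAtMost_iff by linarith
  ultimately have "x - phi (r + of_int i) \<in> unit_box"
    by (cases x) (simp add: unit_box_def phi_def dist_Q2_def norm2_minus_commute)
  thus ?thesis using that dyadic_add_int[OF r(1)] by blast
qed

section \<open>Covering of the unit box by integer translates of the tile\<close>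

lemma dist_K_diff: "dist_K x y = dist_K (x - y) 0"
  by (simp add: dist_K_def)

text \<open>Blow \<open>x\<close> up by \<open>(-3/2) ^ n\<close>, replace it by a dyadic point,
  expand that point and scale back: the error shrinks like \<open>(2/3) ^ n\<close>. The translation
  \<open>l\<close> that remains is dyadic and 2-adically integral, hence an integer.\<close>

lemma unit_box_approx:
  assumes x: "x \<in> unit_box"
  shows "\<exists>i\<in>{-4..4::int}. \<exists>t\<in>tile. dist_K (x - phi (of_int i)) t \<le> (2/3) ^ n"
proof -
  define b :: rat where "b = (- (2/3)) ^ n"
  have inv: "b * (- (3/2)) ^ n = 1" by (simp add: b_def flip: power_mult_distrib)
  obtain m where m: "m \<in> dyadic" "scaleQ ((- (3/2)) ^ n) x - phi m \<in> unit_box"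
    by (rule dyadic_approx)
  obtain l t where lt: "l \<in> dyadic" "t \<in> tile" "phi m = scaleQ ((- (3/2)) ^ n) (phi l + t)"
    using dyadic_expansion[OF m(1)] by blast
  define c where "c = scaleQ ((- (3/2)) ^ n) x - phi m"
  have "scaleQ b (scaleQ ((- (3/2)) ^ n) x) = scaleQ b c + scaleQ b (phi m)"
    by (simp add: c_def flip: scaleQ_add)
  hence eq: "x - phi l - t = scaleQ b c"
    by (simp add: lt(3) scaleQ_scaleQ inv scaleQ_1)
  have "c \<in> unit_box" using m(2) by (simp add: c_def)
  hence "dist_K c 0 \<le> 1" by (cases c) (simp add: dist_K_def unit_box_def dist_Q2_def)
  hence d: "dist_K (scaleQ b c) 0 \<le> (2/3) ^ n"
    using dist_K_affine_K_power[of n 0 c 0]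
      order_trans[OF _ mult_left_le[of "dist_K c 0" "(2/3) ^ n"]]
    by (simp add: affine_K_0 scaleQ_0 b_def)
  also have "(2/3 :: real) ^ n \<le> 1" by (simp add: power_le_one)
  finally have d1: "\<bar>fst (scaleQ b c)\<bar> \<le> 1" "norm2 (snd (scaleQ b c)) \<le> 1"
    by (simp_all add: dist_K_def)
  have t: "\<bar>fst t\<bar> \<le> 2" "norm2 (snd t) \<le> 1"
    using subsetD[OF tile_subset_box lt(2)] by (auto simp: tile_box_def dist_Q2_def mem_Times_iff)
  have x': "0 \<le> fst x" "fst x \<le> 1" "norm2 (snd x) \<le> 1"
    using x by (auto simp: unit_box_def dist_Q2_def mem_Times_iff)
  have l: "phi l = x - t - scaleQ b c" using eq by (simp add: algebra_simps)
  have "of_rat l = snd x - snd t - snd (scaleQ b c)"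
    using arg_cong[OF l, of snd] by (simp add: phi_def)
  hence "abs2_rat l \<le> 1"
    using norm2_ultrametric[of "snd x - snd t" "- snd (scaleQ b c)"]
      norm2_ultrametric[of "snd x" "- snd t"] x' t d1
    by (simp flip: norm_of_rat_Q2)
  then obtain i where i: "l = of_int i" using dyadic_imp_int[OF lt(1)] by blast
  have "real_of_int i = fst x - fst t - fst (scaleQ b c)"
    using arg_cong[OF l, of fst] by (simp add: phi_def i)
  \<comment> \<open>The real parts of \<open>x\<close>, \<open>t\<close> and the error contribute at
    most 1, 2 and 1.\<close>
  hence "i \<in> {-4..4}" using x' t d1 by simp linarith
  moreover have "dist_K (x - phi (of_int i)) t \<le> (2/3) ^ n"
    using d by (subst dist_K_diff) (simp add: i[symmetric] eq)
  ultimately show ?thesis using lt(2) by blast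
qed

text \<open>The set of translations does not depend on \<open>n\<close>. A point outside all these
  closed translates would keep a positive distance from each, against the approximations for large
  \<open>n\<close>.\<close>

lemma unit_box_covered: "unit_box \<subseteq> (\<Union>i\<in>{-4..4::int}. affine_K 1 (- of_int i) -` tile)"
proof
  fix x assume x: "x \<in> unit_box"
  have shift: "affine_K 1 (- of_int i) x = x - phi (of_int i)" for i :: int
    by (cases x) (simp add: affine_K_Pair phi_def of_rat_minus)
  show "x \<in> (\<Union>i\<in>{-4..4::int}. affine_K 1 (- of_int i) -` tile)"
  proof (rule ccontr)
    assume "\<not> ?thesis"
    hence "x - phi (of_int i) \<in> - tile" if "i \<in> {-4..4}" for i
      using that shift by auto
    hence far: "\<exists>e>0. \<forall>y. dist_K (x - phi (of_int i)) y < e \<longrightarrow> y \<in> - tile" if "i \<in> {-4..4}" for i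
      using that closed_tile unfolding closed_def open_K_iff by blast
    have "eventually (\<lambda>n. \<forall>t\<in>tile. \<not> dist_K (x - phi (of_int i)) t \<le> (2/3) ^ n) sequentially"
      if i: "i \<in> {-4..4}" for i
    proof -
      obtain e where e: "e > 0" "\<And>y. dist_K (x - phi (of_int i)) y < e \<Longrightarrow> y \<in> - tile"
        using far[OF i] by blast
      have "eventually (\<lambda>n. (2/3) ^ n < e) sequentially"
        by (rule order_tendstoD(2)[OF LIMSEQ_power_zero e(1)]) simp
      thus ?thesis by eventually_elim (use e(2) in force)
    qed
    hence "eventually (\<lambda>n. \<forall>i\<in>{-4..4}. \<forall>t\<in>tile. \<not> dist_K (x - phi (of_int i)) t \<le> (2/3) ^ n) sequentially"
      by (intro eventually_ball_finite) auto
    then obtain n where "\<forall>i\<in>{-4..4}. \<forall>t\<in>tile. \<not> dist_K (x - phi (of_int i)) t \<le> (2/3) ^ n"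
      by (rule eventually_happens'[OF sequentially_bot, THEN exE])
    thus False using unit_box_approx[OF x, of n] by blast
  qed
qed

section \<open>Nonempty interior of the tile\<close>

lemma interior_UN_closed_empty:
  assumes "finite I" "\<And>i. i \<in> I \<Longrightarrow> closed (A i)" "\<And>i. i \<in> I \<Longrightarrow> interior (A i) = {}"
  shows "interior (\<Union>i\<in>I. A i) = {}"
  using assms
  by (induction I rule: finite_induct) (simp_all add: interior_closed_Un_empty_interior closed_UN)

lemma interior_vimage_affine_K_empty:
  assumes "c \<noteq> 0" "interior A = {}"
  shows "interior (affine_K c r -` A) = {}"
proof -
  let ?U = "affine_K c r ` interior (affine_K c r -` A)"
  have "open ?U"
    unfolding image_affine_K[OF assms(1)] by (intro open_vimage_affine_K open_interior)
  moreover have "?U \<subseteq> A" using interior_subset by blast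
  ultimately have "?U \<subseteq> interior A" by (intro interior_maximal)
  thus ?thesis using assms(2) by blast
qed

text \<open>Finitely many closed sets without interior cannot cover the unit box, which has interior
  because closed 2-adic balls of positive radius are open.\<close>

lemma interior_tile_nonempty: "interior tile \<noteq> {}"
proof
  assume "interior tile = {}"
  hence "interior (\<Union>i\<in>{-4..4::int}. affine_K 1 (- of_int i) -` tile) = {}"
    by (intro interior_UN_closed_empty closed_vimage_affine_K closed_tile
          interior_vimage_affine_K_empty) auto
  moreover have "{0<..<1} \<times> cball 0 1 \<subseteq> interior unit_box"
    unfolding unit_box_def by (intro interior_maximal open_Times open_cball_Q2) auto
  ultimately have "{0<..<1::real} \<times> cball (0::Q2) 1 = {}"
    using interior_mono[OF unit_box_covered] by blast
  moreover have "(1/2, 0) \<in> {0<..<1::real} \<times> cball (0::Q2) 1" by simp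
  ultimately show False by blast
qed

subsection \<open>Scaling of the measure\<close>

lemma emeasure_mu2_cball: "emeasure mu2 (cball a (2 powi k)) = ennreal (2 powi k)"
  by (rule haar_Q2_cball[OF haar_Q2_mu2])

lemma sigma_finite_Q2I:
  fixes M :: "Q2 measure"
  assumes "sets M = sets borel" "\<And>n::nat. emeasure M (cball 0 (2 powi int n)) \<noteq> \<infinity>"
  shows "sigma_finite_measure M"
proof
  have "x \<in> (\<Union>n::nat. cball 0 (2 powi int n))" for x :: Q2
    using real_arch_pow[of 2 "dist 0 x"] by (auto intro: less_imp_le)
  thus "\<exists>A. countable A \<and> A \<subseteq> sets M \<and> \<Union>A = space M \<and> (\<forall>a\<in>A. emeasure M a \<noteq> \<infinity>)"
    using assms sets_eq_imp_space_eq[OF assms(1)]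
    by (intro exI[of _ "range (\<lambda>n::nat. cball 0 (2 powi int n))"]) (auto simp del: power_int_of_nat)
qed

lemma sigma_finite_mu2: "sigma_finite_measure mu2"
  by (rule sigma_finite_Q2I) (simp_all add: emeasure_mu2_cball del: power_int_of_nat)

lemma vimage_affine_cball_Q2:
  fixes c :: Q2
  assumes "c \<noteq> 0" "norm2 c = 2 powi j"
  shows "(\<lambda>x. t + c * x) -` cball a (2 powi k) = cball ((a - t) / c) (2 powi (k - j))"
proof -
  have "norm2 (a - (t + c * x)) = 2 powi j * norm2 ((a - t) / c - x)" for x
    using assms(1) unfolding assms(2)[symmetric] norm2_mult[symmetric] right_diff_distrib
    by (simp add: diff_diff_eq)
  thus ?thesis
    by (auto simp: dist_Q2_def power_int_diff field_simps)
qed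

lemma measurable_affine_Q2: "(\<lambda>x. t + c * x :: Q2) \<in> borel_measurable borel"
  by (intro borel_measurable_continuous_onI)
     (auto simp: continuous_on_def intro!: tendsto_add tendsto_mult_left_Q2)

text \<open>The pushforward divides the measure of each ball by \<open>norm2 c\<close>, the density
  restores it, and the values on balls determine the measure. Sigma-finiteness serves the product
  construction.\<close>

lemma
  fixes c :: Q2
  assumes c: "c \<noteq> 0"
  shows sigma_finite_distr_mu2: "sigma_finite_measure (distr mu2 borel (\<lambda>x. t + c * x))"
    and mu2_affine: "density (distr mu2 borel (\<lambda>x. t + c * x)) (\<lambda>_. ennreal (norm2 c)) = mu2"
proof -
  obtain j where j: "norm2 c = 2 powi j" using c by (rule norm2_cases)
  have meas: "(\<lambda>x. t + c * x) \<in> mu2 \<rightarrow>\<^sub>M borel"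
    unfolding measurable_cong_sets[OF sets_mu2 refl] by (rule measurable_affine_Q2)
  have ball: "emeasure (distr mu2 borel (\<lambda>x. t + c * x)) (cball a (2 powi k)) = ennreal (2 powi (k - j))"
    for a k
    by (subst emeasure_distr[OF meas])
       (simp_all add: vimage_affine_cball_Q2[OF c j] emeasure_mu2_cball sets_eq_imp_space_eq[OF sets_mu2])
  show "sigma_finite_measure (distr mu2 borel (\<lambda>x. t + c * x))"
    by (rule sigma_finite_Q2I) (simp_all only: sets_distr ball ennreal_neq_top infinity_ennreal_def not_False_eq_True)
  show "density (distr mu2 borel (\<lambda>x. t + c * x)) (\<lambda>_. ennreal (norm2 c)) = mu2"
  proof (rule measure_Q2_eqI)
    show "emeasure (density (distr mu2 borel (\<lambda>x. t + c * x)) (\<lambda>_. ennreal (norm2 c)))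
        (cball a (2 powi k)) = ennreal (2 powi k)" for a k
      by (subst emeasure_density_const)
         (simp_all add: ball j flip: ennreal_mult power_int_add)
  qed (simp_all add: emeasure_mu2_cball)
qed

text \<open>Both factors of \<open>mu\<close> are weighted pushforwards of themselves. Their product
  is the pushforward under the affine map, weighted by the product of the two absolute values of
  \<open>c\<close>.\<close>

lemma emeasure_mu_vimage_affine_K:
  assumes c: "c \<noteq> 0" and A: "A \<in> sets borel"
  shows "emeasure mu A = ennreal (\<bar>of_rat c\<bar> * abs2_rat c) * emeasure mu (affine_K c r -` A)"
proof -
  let ?f = "\<lambda>x. of_rat r + of_rat c * x :: real" and ?g = "\<lambda>y. of_rat r + of_rat c * y :: Q2"
  have g: "?g \<in> mu2 \<rightarrow>\<^sub>M borel"
    unfolding measurable_cong_sets[OF sets_mu2 refl] by (rule measurable_affine_Q2)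
  have c2: "(of_rat c :: Q2) \<noteq> 0" using c by simp
  note sf = sigma_finite_distr_mu2[OF c2, of "of_rat r"]
  note mu2_eq = mu2_affine[OF c2, of "of_rat r"]
  have sf2: "sigma_finite_measure (density (distr mu2 borel ?g) (\<lambda>_. ennreal (abs2_rat c)))"
    using mu2_eq sigma_finite_mu2 by simp
  have fg: "affine_K c r = (\<lambda>(x, y). (?f x, ?g y))"
    by (simp add: fun_eq_iff affine_K_Pair)
  have "affine_K c r \<in> lborel \<Otimes>\<^sub>M mu2 \<rightarrow>\<^sub>M borel \<Otimes>\<^sub>M borel"
    unfolding fg using g by measurable
  hence meas: "affine_K c r \<in> mu \<rightarrow>\<^sub>M borel \<Otimes>\<^sub>M borel"
    by (simp add: mu_def)
  have "mu = density (distr lborel borel ?f) (\<lambda>_. ennreal \<bar>of_rat c\<bar>) \<Otimes>\<^sub>M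
             density (distr mu2 borel ?g) (\<lambda>_. ennreal (abs2_rat c))"
    unfolding mu_def using mu2_eq lborel_real_affine[of "of_rat c" "of_rat r"] c by simp
  also have "\<dots> = density (distr lborel borel ?f \<Otimes>\<^sub>M distr mu2 borel ?g)
                     (\<lambda>_. ennreal \<bar>of_rat c\<bar> * ennreal (abs2_rat c))"
    by (subst pair_measure_density) (simp_all add: sf sf2 case_prod_unfold)
  also have "distr lborel borel ?f \<Otimes>\<^sub>M distr mu2 borel ?g = distr mu (borel \<Otimes>\<^sub>M borel) (affine_K c r)"
    unfolding mu_def fg by (rule pair_measure_distr[OF _ g sf]) simp
  finally have mu_eq: "mu = density (distr mu (borel \<Otimes>\<^sub>M borel) (affine_K c r))
      (\<lambda>_. ennreal \<bar>of_rat c\<bar> * ennreal (abs2_rat c))" .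
  have A': "A \<in> sets (borel \<Otimes>\<^sub>M borel)" using A unfolding borel_prod .
  have "space mu = UNIV" using sets_eq_imp_space_eq[OF sets_mu] by simp
  thus ?thesis
    by (subst mu_eq, subst emeasure_density_const)
       (simp_all add: A' emeasure_distr[OF meas A'] ennreal_mult)
qed

lemma emeasure_piece_map_image:
  assumes "closed A"
  shows "emeasure mu (piece_map w ` A) = ennreal ((1/3) ^ length w) * emeasure mu A"
proof -
  let ?c = "(- (2/3)) ^ length w :: rat"
  \<comment> \<open>Each letter contributes \<open>2/3 * 1/2 = 1/3\<close>.\<close>
  have "\<bar>of_rat ?c\<bar> * abs2_rat ?c = (1/3 :: real) ^ length w"
    by (simp add: abs2_rat_power abs2_rat_two_thirds of_rat_power of_rat_minus of_rat_divide power_abs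
        flip: power_mult_distrib del: power_divide)
  moreover have "affine_K ?c (offset w) -` (affine_K ?c (offset w) ` A) = A"
    by (rule inj_vimage_image_eq[OF inj_affine_K]) simp
  moreover have "affine_K ?c (offset w) ` A \<in> sets borel"
    by (intro borel_closed closed_image_affine_K assms) simp
  ultimately show ?thesis
    unfolding piece_map_def by (subst emeasure_mu_vimage_affine_K[of ?c _ "offset w"]) simp_all
qed

lemma closed_piece: "closed (piece_map w ` tile)"
  unfolding piece_map_def by (intro closed_image_affine_K closed_tile) simp

lemma emeasure_tile_finite: "emeasure mu tile \<noteq> \<infinity>"
proof -
  interpret mu2: sigma_finite_measure mu2
    by (rule sigma_finite_mu2)
  have "emeasure mu tile \<le> emeasure mu tile_box"
    by (intro emeasure_mono tile_subset_box) (simp add: sets_mu closed_box)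
  \<comment> \<open>The interval has length 4 and the ball of radius \<open>2 powi 0\<close> has
    measure 1.\<close>
  also have "\<dots> = 4"
    unfolding tile_box_def mu_def using emeasure_mu2_cball[of 0 0]
    by (subst mu2.emeasure_pair_measure_Times) simp_all
  finally show ?thesis by (auto simp: top_unique)
qed

subsection \<open>Pieces of the tile\<close>

definition words :: "nat \<Rightarrow> rat list set"
  where "words n = {w. set w \<subseteq> digits \<and> length w = n}"

lemma finite_words: "finite (words n)"
  unfolding words_def by (rule finite_lists_length_eq) (simp add: digits_def)

lemma card_words: "card (words n) = 3 ^ n"
  unfolding words_def by (subst card_lists_length_eq) (simp_all add: digits_def numeral_3_eq_3)

lemma tile_eq_pieces: "tile = (\<Union>w\<in>words n. piece_map w ` tile)"
proof (intro equalityI subsetI)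
  fix x assume "x \<in> tile"
  thus "x \<in> (\<Union>w\<in>words n. piece_map w ` tile)"
  proof (induction n arbitrary: x)
    case 0
    thus ?case by (auto simp: words_def intro!: image_eqI[of _ _ x])
  next
    case (Suc n)
    obtain d y where dy: "d \<in> digits" "y \<in> tile" "x = piece_map [d] y"
      using Suc.prems by (rule tile_unfold)
    obtain w z where "w \<in> words n" "z \<in> tile" "y = piece_map w z"
      using Suc.IH[OF dy(2)] by blast
    hence "d # w \<in> words (Suc n)" "x = piece_map (d # w) z"
      using dy by (simp_all add: words_def piece_map_Cons[of d w])
    thus ?case using \<open>z \<in> tile\<close> by blast
  qed
next
  have "piece_map w y \<in> tile" if "set w \<subseteq> digits" "y \<in> tile" for w y
    using that
  proof (induction w)
    case (Cons d w)
    thus ?case by (subst piece_map_Cons) (simp add: piece_map_in_tile)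
  qed simp
  thus "x \<in> tile" if "x \<in> (\<Union>w\<in>words n. piece_map w ` tile)" for x
    using that by (auto simp: words_def)
qed

text \<open>Inclusion-exclusion for \<open>A i\<close> and the union of the others: additivity
  leaves no mass for their intersection, and finiteness permits the cancellation.\<close>

lemma null_sets_Int_if_emeasure_UN_eq_sum:
  assumes "finite I" and A: "\<And>i. i \<in> I \<Longrightarrow> A i \<in> sets M"
    and eq: "emeasure M (\<Union>i\<in>I. A i) = (\<Sum>i\<in>I. emeasure M (A i))"
    and fin: "emeasure M (\<Union>i\<in>I. A i) \<noteq> \<infinity>"
    and ij: "i \<in> I" "j \<in> I" "i \<noteq> j"
  shows "A i \<inter> A j \<in> null_sets M"
proof -
  let ?U = "\<Union>k\<in>I - {i}. A k" and ?V = "\<Union>i\<in>I. A i"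
  have U: "?U \<in> sets M" using assms by (intro sets.finite_UN) auto
  have V: "A i \<union> ?U = ?V" using ij by auto
  have "emeasure M ?V + emeasure M (A i \<inter> ?U) = emeasure M (A i) + emeasure M ?U"
    using emeasure_Un_Int[OF A[OF ij(1)] U] unfolding V by simp
  also have "\<dots> \<le> emeasure M (A i) + (\<Sum>k\<in>I - {i}. emeasure M (A k))"
    using assms by (intro add_left_mono emeasure_subadditive_finite) auto
  also have "\<dots> = emeasure M ?V + 0"
    using sum.remove[OF assms(1) ij(1), of "\<lambda>k. emeasure M (A k)"] by (simp add: eq)
  finally have "emeasure M (A i \<inter> ?U) = 0"
    using fin by (simp only: ennreal_add_left_cancel_le) simp
  hence "A i \<inter> ?U \<in> null_sets M" using A[OF ij(1)] U by auto
  thus ?thesis using ij A by (elim null_sets_subset) auto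
qed

text \<open>The \<open>3 ^ n\<close> pieces each carry the fraction \<open>(1/3) ^ n\<close> of the
  finite measure of their union, the tile.\<close>

lemma pieces_overlap_null:
  assumes "v \<in> words n" "w \<in> words n" "v \<noteq> w"
  shows "piece_map v ` tile \<inter> piece_map w ` tile \<in> null_sets mu"
proof (rule null_sets_Int_if_emeasure_UN_eq_sum[OF finite_words _ _ _ assms])
  have "(\<Sum>w\<in>words n. emeasure mu (piece_map w ` tile)) =
        (\<Sum>w\<in>words n. ennreal ((1/3) ^ n) * emeasure mu tile)"
    by (intro sum.cong) (auto simp: words_def emeasure_piece_map_image closed_tile)
  also have "\<dots> = (of_nat (3 ^ n) * ennreal ((1/3) ^ n)) * emeasure mu tile"
    by (simp add: card_words mult.assoc)
  also have "of_nat (3 ^ n) * ennreal ((1/3) ^ n) = 1"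
    by (simp add: ennreal_of_nat_eq_real_of_nat power_divide flip: ennreal_mult del: of_nat_power)
  finally show "emeasure mu (\<Union>w\<in>words n. piece_map w ` tile) =
      (\<Sum>w\<in>words n. emeasure mu (piece_map w ` tile))"
    by (simp flip: tile_eq_pieces)
  show "emeasure mu (\<Union>w\<in>words n. piece_map w ` tile) \<noteq> \<infinity>"
    using emeasure_tile_finite by (simp flip: tile_eq_pieces)
qed (simp add: sets_mu closed_piece)

section \<open>Passage from null overlaps to a null boundary\<close>

theorem theorem5:
  shows "frontier tile \<in> null_sets mu"
proof -
  obtain x where x: "x \<in> interior tile" using interior_tile_nonempty by blast
  obtain e where e: "e > 0" "\<And>y. dist_K x y < e \<Longrightarrow> y \<in> interior tile"
    using open_interior[of tile] x unfolding open_K_iff by blast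
  \<comment> \<open>As 4 bounds the diameter of the tile, pieces of level \<open>n\<close> get
    diameter below \<open>e\<close>.\<close>
  have "eventually (\<lambda>n. (2/3) ^ n < e / 4) sequentially"
    by (rule order_tendstoD(2)[OF LIMSEQ_power_zero]) (use e(1) in auto)
  then obtain n where n: "(2/3) ^ n < e / 4"
    by (auto simp: eventually_sequentially)
  have "x \<in> tile" using x interior_subset by blast
  then obtain w z where w: "w \<in> words n" and z: "z \<in> tile" "x = piece_map w z"
    using tile_eq_pieces[of n] by blast
  have inside: "piece_map w ` tile \<subseteq> interior tile"
  proof
    fix y assume "y \<in> piece_map w ` tile"
    then obtain y' where y': "y' \<in> tile" "y = piece_map w y'" by blast
    have "dist_K x y \<le> (2/3) ^ n * dist_K z y'"
      using dist_K_piece_map[of w z y'] w by (simp add: z y' words_def)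
    also have "\<dots> \<le> (2/3) ^ n * 4"
      using z(1) y'(1) tile_subset_box by (intro mult_left_mono box_dist_K_le) auto
    finally show "y \<in> interior tile" using n by (intro e(2)) simp
  qed
  let ?R = "\<Union>v\<in>words n - {w}. piece_map v ` tile"
  have overlap: "piece_map w ` frontier tile \<subseteq> piece_map w ` tile \<inter> ?R"
  proof
    fix y assume "y \<in> piece_map w ` frontier tile"
    then obtain u where u: "u \<in> frontier tile" "y = piece_map w u" by blast
    hence y: "y \<in> piece_map w ` tile"
      using frontier_subset_closed[OF closed_tile] by blast
    have "y \<in> ?R"
    proof (rule ccontr)
      assume y': "y \<notin> ?R"
      \<comment> \<open>Near a point missing the other pieces, the tile coincides with the piece of
        \<open>w\<close>; pulling that neighbourhood back would make \<open>u\<close> an interior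
        point.\<close>
      let ?V = "piece_map w -` (interior tile - ?R)"
      have "closed ?R"
        by (intro closed_UN finite_Diff finite_words ballI closed_piece)
      hence "open ?V"
        unfolding piece_map_def by (intro open_vimage_affine_K open_Diff open_interior)
      moreover have "u \<in> ?V" using y y' u inside by auto
      moreover have "?V \<subseteq> tile"
      proof
        fix v assume "v \<in> ?V"
        hence "piece_map w v \<in> tile - ?R" using interior_subset by blast
        hence "piece_map w v \<in> piece_map w ` tile" using tile_eq_pieces[of n] by blast
        thus "v \<in> tile"
          unfolding piece_map_def by (subst (asm) inj_image_mem_iff[OF inj_affine_K]) simp_all
      qed
      ultimately have "u \<in> interior tile" by (blast intro: interiorI)
      thus False using u(1) by (simp add: frontier_def)
    qed
    with y show "y \<in> piece_map w ` tile \<inter> ?R" by blast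
  qed
  have "(\<Union>v\<in>words n - {w}. piece_map w ` tile \<inter> piece_map v ` tile) \<in> null_sets mu"
    using w by (intro null_sets.finite_UN finite_Diff finite_words pieces_overlap_null) auto
  moreover have "piece_map w ` frontier tile \<in> sets mu"
    unfolding sets_mu piece_map_def
    by (intro borel_closed closed_image_affine_K) simp_all
  ultimately have "piece_map w ` frontier tile \<in> null_sets mu"
    using overlap by (elim null_sets_subset) auto
  \<comment> \<open>The scaling factor is positive, so nullity passes back from the piece to the
    whole tile.\<close>
  hence "ennreal ((1/3) ^ length w) * emeasure mu (frontier tile) = 0"
    using emeasure_piece_map_image[of "frontier tile" w] by (simp add: null_setsD1)
  hence "emeasure mu (frontier tile) = 0" by simp
  thus ?thesis by (intro null_setsI) (simp_all add: sets_mu)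
qed

end
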